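(* Let $\mathcal{H}$ be a Hilbert space, let $A\in\mathcal{B}(\mathcal{H})$ satisfy $0\le A\le 1$ and $\ker A=\{0\}$. Let $Q_0,Q_1\in Gr_A$ be such that $\|Q_0-Q_1\|<r_{Q_0}$. Then the unique geodesic of $\mathcal{Q}(\mathcal{H})$ which joins them, and lies inside $Gr_A$, namely $\delta(t)=e^{tX}Q_0e^{-tX}$, $t\in[0,1]$, has minimal length among all possible piecewise smooth curves in $Gr_A$ joining $Q_0$ and $Q_1$: that is, $L_{Gr_A}(\delta)\le L_{Gr_A}(\gamma)$ for every such curve $\gamma$.
   Context: $\mathcal{H}$ is a complex Hilbert space with inner product $\langle\cdot,\cdot\rangle$; $\|\cdot\|$ is the operator norm of $\mathcal{B}(\mathcal{H})$; $\mathcal{L}$ is the completion of $\mathcal{H}$ for the inner product $[f,g]=\langle Af,g\rangle$. $\mathcal{B}^A_s(\mathcal{H})=\{B\in\mathcal{B}(\mathcal{H}):B^*A=AB\}$; every $B\in\mathcal{B}^A_s(\mathcal{H})$ extends uniquely to a bounded self-adjoint operator $\bar{B}$ on $\mathcal{L}$. $Gr_A=\{Q\in\mathcal{B}(\mathcal{H}): Q^2=Q,\ Q^*A=AQ\}$ is a submanifold of $\mathcal{B}^A_s(\mathcal{H})$, with tangent spaces $(TGr_A)_Q=\{XQ-QX:X\in\mathcal{B}(\mathcal{H}),\ X^*A=-AX\}$. The Finsler metric on $Gr_A$ is $|v|_Q=\|\bar{v}\|_{\mathcal{B}(\mathcal{L})}$ for $v\in(TGr_A)_Q$, and the length of a piecewise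 smooth curve $\gamma:[0,1]\to Gr_A$ is $L_{Gr_A}(\gamma)=\int_0^1\|\overline{\dot\gamma(t)}\|_{\mathcal{B}(\mathcal{L})}\,dt$. $\mathcal{Q}(\mathcal{H})$ is the manifold of all idempotents in $\mathcal{B}(\mathcal{H})$; its geodesics starting at $Q_0$ are the curves $e^{tX}Q_0e^{-tX}$ with $Q_0XQ_0=(1-Q_0)X(1-Q_0)=0$. For an idempotent $Q$ put $\epsilon_Q=2Q-1$, and for $Q_0\in Gr_A$ put $r_{Q_0}=\frac{1}{2\|\epsilon_{Q_0}\|}$. If $Q_1\in Gr_A$ and $\|Q_0-Q_1\|<r_{Q_0}$, then $\|\epsilon_{Q_1}\epsilon_{Q_0}-1\|<1$, and the geodesic referred to as the unique one joining $Q_0$ and $Q_1$ is the one with exponent $X=\frac12\sum_{n\ge1}\frac{(-1)^{n+1}}{n}(\epsilon_{Q_1}\epsilon_{Q_0}-1)^n$, which satisfies $X^*A=-AX$, $Q_0XQ_0=(1-Q_0)X(1-Q_0)=0$ and $Q_1=e^XQ_0e^{-X}$. *)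

theory Defs
  imports "HOL-Analysis.Analysis"
begin

text \<open>
  Complex Hilbert spaces. The inner product is linear in the first argument. The norm, the
  topology and completeness are those of the underlying real Hilbert space, whose inner product
  is the real part of the complex one.
\<close>

class complex_hilbert = banach + real_inner +
  fixes scaleC :: "complex \<Rightarrow> 'a \<Rightarrow> 'a" (infixr "*\<^sub>C" 75)
    and cinner :: "'a \<Rightarrow> 'a \<Rightarrow> complex"
  assumes scaleR_scaleC: "r *\<^sub>R x = complex_of_real r *\<^sub>C x"
    and scaleC_add_right: "c *\<^sub>C (x + y) = c *\<^sub>C x + c *\<^sub>C y"
    and scaleC_add_left: "(c + d) *\<^sub>C x = c *\<^sub>C x + d *\<^sub>C x"
    and scaleC_scaleC: "c *\<^sub>C d *\<^sub>C x = (c * d) *\<^sub>C x"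
    and cinner_commute: "cinner x y = cnj (cinner y x)"
    and cinner_add_left: "cinner (x + y) z = cinner x z + cinner y z"
    and cinner_scaleC_left: "cinner (c *\<^sub>C x) y = c * cinner x y"
    and inner_eq_Re_cinner: "inner x y = Re (cinner x y)"

instantiation complex :: complex_hilbert
begin

definition scaleC_complex :: "complex \<Rightarrow> complex \<Rightarrow> complex"
  where "scaleC_complex c x = c * x"

definition cinner_complex :: "complex \<Rightarrow> complex \<Rightarrow> complex"
  where "cinner_complex x y = x * cnj y"

instance
  by standard
    (simp_all add: scaleC_complex_def cinner_complex_def scaleR_conv_of_real algebra_simps
      inner_complex_def)

end

text \<open>
  Operators are elements of the Banach space of bounded real-linear maps, whose norm is the
  operator norm; the bounded complex-linear ones are singled out by the following set.
\<close>

type_synonym 'a op = "'a \<Rightarrow>\<^sub>L 'a"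

definition bounded_ops :: "'a::complex_hilbert op set"
  where "bounded_ops = {B. \<forall>c f. blinfun_apply B (c *\<^sub>C f) = c *\<^sub>C blinfun_apply B f}"

definition adj :: "'a::complex_hilbert op \<Rightarrow> 'a op"
  where "adj B = (THE C. C \<in> bounded_ops \<and>
    (\<forall>f g. cinner (blinfun_apply B f) g = cinner f (blinfun_apply C g)))"

definition positive_op :: "'a::complex_hilbert op \<Rightarrow> bool"
  where "positive_op T \<longleftrightarrow> T \<in> bounded_ops \<and> (\<forall>f. cinner (blinfun_apply T f) f \<in> \<real>\<^sub>\<ge>\<^sub>0)"

text \<open>
  The instance of \<^typ>\<open>'a \<Rightarrow>\<^sub>L 'a\<close> as a unital normed algebra is not available (the identity has
  norm 0 on the zero space), so powers and the exponential are written out for composition.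
\<close>

definition op_power :: "'a::complex_hilbert op \<Rightarrow> nat \<Rightarrow> 'a op"
  where "op_power B n = ((\<lambda>C. B o\<^sub>L C) ^^ n) id_blinfun"

definition op_exp :: "'a::complex_hilbert op \<Rightarrow> 'a op"
  where "op_exp B = (\<Sum>n. (1 / fact n) *\<^sub>R op_power B n)"

definition idempotents :: "'a::complex_hilbert op set"
  where "idempotents = {Q \<in> bounded_ops. Q o\<^sub>L Q = Q}"

definition symmetric_ops :: "'a::complex_hilbert op \<Rightarrow> 'a op set"
  where "symmetric_ops A = {B \<in> bounded_ops. adj B o\<^sub>L A = A o\<^sub>L B}"

definition Gr :: "'a::complex_hilbert op \<Rightarrow> 'a op set"
  where "Gr A = idempotents \<inter> symmetric_ops A"

text \<open>
  \<open>J\<close> exhibits \<open>'b\<close> as a completion of \<open>'a\<close> with respect to the inner product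
  \<open>[f, g] = \<langle>A f, g\<rangle>\<close>. Such a completion is unique up to a unitary intertwining the embeddings.
  For \<open>A\<close> positive and injective one can always be found on \<open>'a\<close> itself, with \<open>J\<close> the positive
  square root of \<open>A\<close>.
\<close>

definition hilbert_completion :: "'a::complex_hilbert op \<Rightarrow> ('a \<Rightarrow> 'b::complex_hilbert) \<Rightarrow> bool"
  where "hilbert_completion A J \<longleftrightarrow>
    (\<forall>f g. J (f + g) = J f + J g) \<and>
    (\<forall>c f. J (c *\<^sub>C f) = c *\<^sub>C J f) \<and>
    (\<forall>f g. cinner (J f) (J g) = cinner (blinfun_apply A f) g) \<and>
    closure (range J) = UNIV"

definition extension ::
    "('a::complex_hilbert \<Rightarrow> 'b::complex_hilbert) \<Rightarrow> 'a op \<Rightarrow> 'b op"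
  where "extension J B = (THE C. C \<in> bounded_ops \<and>
    (\<forall>f. blinfun_apply C (J f) = J (blinfun_apply B f)))"

text \<open>The Finsler norm of a tangent vector does not depend on its base point.\<close>

definition finsler ::
    "('a::complex_hilbert \<Rightarrow> 'b::complex_hilbert) \<Rightarrow> 'a op \<Rightarrow> real"
  where "finsler J v = norm (extension J v)"

text \<open>
  All derivatives on \<open>[a, b]\<close> are required to exist up to the end points (one-sidedly there);
  \<open>D k\<close> is the \<open>k\<close>-th one.
\<close>

definition smooth_on_interval :: "real \<Rightarrow> real \<Rightarrow> (real \<Rightarrow> 'v::real_normed_vector) \<Rightarrow> bool"
  where "smooth_on_interval a b \<gamma> \<longleftrightarrow> (\<exists>D :: nat \<Rightarrow> real \<Rightarrow> 'v.
    (\<forall>t\<in>{a..b}. D 0 t = \<gamma> t) \<and>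
    (\<forall>k. \<forall>t\<in>{a..b}. (D k has_vector_derivative D (Suc k) t) (at t within {a..b})))"

definition piecewise_smooth :: "(real \<Rightarrow> 'v::real_normed_vector) \<Rightarrow> bool"
  where "piecewise_smooth \<gamma> \<longleftrightarrow> (\<exists>(n::nat) (s::nat \<Rightarrow> real). s 0 = 0 \<and> s n = 1 \<and>
    (\<forall>i<n. s i < s (Suc i) \<and> smooth_on_interval (s i) (s (Suc i)) \<gamma>))"

definition joining_curve ::
    "'a::complex_hilbert op \<Rightarrow> 'a op \<Rightarrow> 'a op \<Rightarrow> (real \<Rightarrow> 'a op) \<Rightarrow> bool"
  where "joining_curve A Q\<^sub>0 Q\<^sub>1 \<gamma> \<longleftrightarrow> piecewise_smooth \<gamma> \<and> (\<forall>t\<in>{0..1}. \<gamma> t \<in> Gr A) \<and>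
    \<gamma> 0 = Q\<^sub>0 \<and> \<gamma> 1 = Q\<^sub>1"

text \<open>
  For piecewise smooth \<open>\<gamma>\<close> the integrand is bounded and continuous off the finitely many break
  points, where the derivative may fail to exist.
\<close>

definition curve_length ::
    "('a::complex_hilbert \<Rightarrow> 'b::complex_hilbert) \<Rightarrow> (real \<Rightarrow> 'a op) \<Rightarrow> real"
  where "curve_length J \<gamma> =
    integral {0..1} (\<lambda>t. finsler J (vector_derivative \<gamma> (at t within {0..1})))"

definition orbit_curve :: "'a::complex_hilbert op \<Rightarrow> 'a op \<Rightarrow> real \<Rightarrow> 'a op"
  where "orbit_curve Q\<^sub>0 X t = op_exp (t *\<^sub>R X) o\<^sub>L Q\<^sub>0 o\<^sub>L op_exp (- (t *\<^sub>R X))"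

definition idempotent_geodesic :: "'a::complex_hilbert op \<Rightarrow> (real \<Rightarrow> 'a op) \<Rightarrow> bool"
  where "idempotent_geodesic Q\<^sub>0 \<gamma> \<longleftrightarrow> Q\<^sub>0 \<in> idempotents \<and> (\<exists>X\<in>bounded_ops.
    Q\<^sub>0 o\<^sub>L X o\<^sub>L Q\<^sub>0 = 0 \<and> (id_blinfun - Q\<^sub>0) o\<^sub>L X o\<^sub>L (id_blinfun - Q\<^sub>0) = 0 \<and>
    \<gamma> = orbit_curve Q\<^sub>0 X)"

definition eps :: "'a::complex_hilbert op \<Rightarrow> 'a op"
  where "eps Q = 2 *\<^sub>R Q - id_blinfun"

definition geodesic_radius :: "'a::complex_hilbert op \<Rightarrow> real"
  where "geodesic_radius Q = 1 / (2 * norm (eps Q))"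

text \<open>
  Half the logarithm of \<open>eps Q\<^sub>1 \<circ> eps Q\<^sub>0\<close>, by its power series around the identity. The summation
  index is shifted by one to start at 0.
\<close>

definition geodesic_exponent :: "'a::complex_hilbert op \<Rightarrow> 'a op \<Rightarrow> 'a op"
  where "geodesic_exponent Q\<^sub>0 Q\<^sub>1 = (1 / 2) *\<^sub>R (\<Sum>n. ((-1) ^ (Suc n + 1) / real (Suc n)) *\<^sub>R
    op_power ((eps Q\<^sub>1 o\<^sub>L eps Q\<^sub>0) - id_blinfun) (Suc n))"

end

theory Submission
  imports Defs
begin

text \<open>
The idea is to leave \<open>Gr A\<close> for the unit sphere of the completion. Every operator that is symmetric
for \<open>[f, g] = \<langle>A f, g\<rangle>\<close> extends to a self-adjoint operator on the completion without increasing its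
norm (\<open>norm_J_symmetric_le\<close>), and the Finsler length of a curve in \<open>Gr A\<close> is the length, in the
operator norm of the completion, of the extended curve, which consists of orthogonal projections
\<open>P(t)\<close>. The geodesic extends to the curve \<open>exp(t X) P(0) exp(- t X)\<close> with the same formula for the exponent. There \<open>X\<close> is
skew-adjoint and anticommutes with the reflection \<open>eps (P(0))\<close>; hence the velocity is at most
\<open>\<parallel>X\<parallel>\<close> in norm, and so is the length of the geodesic.

For the lower bound take a unit vector \<open>x\<close> of the completion and a curve from \<open>P\<^sub>0\<close> to \<open>P\<^sub>1\<close>. The
reflections \<open>eps (P(t))\<close> are isometries, so \<open>t \<mapsto> eps (P(t)) (eps P\<^sub>0 x)\<close> is a path on the unit sphere
from \<open>x\<close> to \<open>U x\<close>, where \<open>U = eps P\<^sub>1 \<circ> eps P\<^sub>0 = exp(2 X)\<close>. Its speed is at most twice that of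
\<open>P(t)\<close>, and the angle between the end points of a path on the sphere is at most its length
(\<open>sphere_distance_le_length\<close>). Therefore \<open>U\<close> moves no unit vector through an angle larger than
twice the length of the curve (\<open>angle_le_curve_length\<close>).

It remains to see that some unit vectors are moved through an angle as close to \<open>2 \<parallel>X\<parallel>\<close> as desired.
A bounded skew-adjoint \<open>Z = 2 X\<close> has \<open>\<i> l\<close> with \<open>\<bar>l\<bar> = \<parallel>Z\<parallel>\<close> as an approximate eigenvalue
(\<open>skew_approx_eigenvalue\<close>). Along the same sequence of unit vectors \<open>U = exp Z\<close> has the approximate
eigenvalue \<open>exp(\<i> l)\<close>, and \<open>Z = log U\<close>, a convergent power series in \<open>U - 1\<close> because
\<open>\<parallel>U - 1\<parallel> < 1\<close>, has the approximate eigenvalue \<open>Ln (exp(\<i> l))\<close>. Approximate eigenvalues are unique,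
so \<open>\<i> l\<close> is a principal logarithm of a number with positive real part. Hence \<open>\<bar>l\<bar> < pi / 2\<close>, and the
angles in question tend to \<open>arccos (cos l) = \<parallel>Z\<parallel>\<close> (\<open>norm_log_le_angle\<close>).

That the power series for the exponent gives a codiagonal, respectively skew, operator and that the
geodesic ends at \<open>Q\<^sub>1\<close> are consequences of two identities for the logarithm in a Banach algebra,
\<open>exp_log1p\<close> and \<open>log1p_inverse\<close>, since conjugation by \<open>eps Q\<^sub>0\<close>, as well as passing to adjoints on
the completion, turns \<open>eps Q\<^sub>1 \<circ> eps Q\<^sub>0\<close> into its inverse.
\<close>

section \<open>Exponential and logarithm in a Banach algebra\<close>

lemma power_intertwine:
  fixes a x y :: "'a::monoid_mult"
  assumes "a * x = y * a"
  shows "a * x ^ n = y ^ n * a"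
proof (induction n)
  case (Suc n)
  have "a * x ^ Suc n = y * (a * x ^ n)"
    using assms by (simp add: mult.assoc[symmetric])
  then show ?case by (simp add: Suc mult.assoc)
qed simp

text \<open>
With \<open>x = y\<close> this says that whatever commutes with \<open>x\<close> commutes with \<open>exp x\<close>; with an involution
\<open>a\<close> it describes conjugation. The same form is used for the logarithm below.
\<close>

lemma exp_intertwine:
  fixes a x y :: "'a::{real_normed_algebra_1,banach}"
  assumes "a * x = y * a"
  shows "a * exp x = exp y * a"
proof -
  have "a * exp x = (\<Sum>n. a * (x ^ n /\<^sub>R fact n))"
    unfolding exp_def by (rule suminf_mult[symmetric]) (rule summable_exp_generic)
  also have "\<dots> = (\<Sum>n. (y ^ n /\<^sub>R fact n) * a)"
    by (simp add: power_intertwine[OF assms])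
  also have "\<dots> = exp y * a"
    unfolding exp_def by (rule suminf_mult2[symmetric]) (rule summable_exp_generic)
  finally show ?thesis .
qed

lemma norm_exp_minus_linear_part:
  fixes x :: "'a::{real_normed_algebra_1,banach}"
  shows "norm (exp x - 1 - x) \<le> (norm x)\<^sup>2 * exp (norm x)"
proof -
  let ?f = "\<lambda>n. inverse (fact (n + 2)) *\<^sub>R x ^ (n + 2)"
  have bound: "norm (?f n) \<le> (norm x)\<^sup>2 * (norm x ^ n /\<^sub>R fact n)" for n
  proof -
    have "norm (?f n) \<le> inverse (fact (n + 2)) * norm x ^ (n + 2)"
      using norm_power_ineq[of x "n + 2"] by (simp add: mult_left_mono)
    also have "\<dots> \<le> inverse (fact n) * norm x ^ (n + 2)"
      by (intro mult_right_mono le_imp_inverse_le fact_mono) auto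
    finally show ?thesis by (simp add: power_add mult_ac power2_eq_square)
  qed
  have summ: "summable (\<lambda>n. (norm x)\<^sup>2 * (norm x ^ n /\<^sub>R fact n))"
    by (intro summable_mult summable_exp_generic)
  have "norm (suminf ?f) \<le> (\<Sum>n. (norm x)\<^sup>2 * (norm x ^ n /\<^sub>R fact n))"
    by (rule norm_suminf_le[OF bound summ])
  also have "\<dots> = (norm x)\<^sup>2 * exp (norm x)"
    unfolding exp_def by (rule suminf_mult) (rule summable_exp_generic)
  finally show ?thesis
    using exp_first_two_terms[of x] by (simp add: algebra_simps)
qed

lemma exp_has_derivative_at_0:
  "(exp has_derivative (\<lambda>h. h)) (at (0::'a::{real_normed_algebra_1,banach}))"
  unfolding has_derivative_at
proof
  show "(\<lambda>h::'a. norm (exp (0 + h) - exp 0 - h) / norm h) \<midarrow>0\<rightarrow> 0"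
  proof (rule tendsto_sandwich[OF _ _ tendsto_const])
    show "\<forall>\<^sub>F h::'a in at 0. norm (exp (0 + h) - exp 0 - h) / norm h \<le> norm h * exp (norm h)"
      using norm_exp_minus_linear_part
      by (intro always_eventually allI)
        (auto simp: divide_simps power2_eq_square mult_ac)
    show "((\<lambda>h::'a. norm h * exp (norm h)) \<longlongrightarrow> 0) (at 0)"
      by (rule tendsto_eq_intros refl | simp)+
  qed simp
qed (rule bounded_linear_ident)

text \<open>
In a noncommutative algebra the chain rule for \<open>exp\<close> needs that the values of the path commute:
then \<open>exp (M s) = exp (M t) * exp (M s - M t)\<close>, and only the derivative of \<open>exp\<close> at 0 enters.
\<close>

lemma exp_commuting_has_vector_derivative:
  fixes M :: "real \<Rightarrow> 'a::{real_normed_algebra_1,banach}"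
  assumes der: "(M has_vector_derivative M') (at t within S)" and "t \<in> S"
    and comm: "\<And>s. s \<in> S \<Longrightarrow> M s * M t = M t * M s"
  shows "((\<lambda>s. exp (M s)) has_vector_derivative exp (M t) * M') (at t within S)"
proof -
  have "((\<lambda>s. M s - M t) has_derivative (\<lambda>h. h *\<^sub>R M')) (at t within S)"
    using der by (auto simp: has_vector_derivative_def intro!: derivative_eq_intros)
  from has_derivative_compose[OF this] exp_has_derivative_at_0
  have "((\<lambda>s. exp (M s - M t)) has_derivative (\<lambda>h. h *\<^sub>R M')) (at t within S)"
    by simp
  then have "((\<lambda>s. exp (M t) * exp (M s - M t)) has_derivative (\<lambda>h. exp (M t) * (h *\<^sub>R M'))) (at t within S)"
    by (rule has_derivative_mult_right)
  moreover have "exp (M t) * exp (M s - M t) = exp (M s)" if "s \<in> S" for s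
    using comm[OF that] by (subst exp_add_commuting[symmetric]) (simp_all add: algebra_simps)
  ultimately have "((\<lambda>s. exp (M s)) has_derivative (\<lambda>h. exp (M t) * (h *\<^sub>R M'))) (at t within S)"
    using \<open>t \<in> S\<close> by (rule_tac has_derivative_transform) auto
  then show ?thesis by (simp add: has_vector_derivative_def)
qed

definition log1p :: "'a::{real_normed_algebra_1,banach} \<Rightarrow> 'a"
  where "log1p y = (\<Sum>n. ((-1) ^ n / real (Suc n)) *\<^sub>R y ^ Suc n)"

definition neumann :: "'a::{real_normed_algebra_1,banach} \<Rightarrow> 'a"
  where "neumann y = (\<Sum>n. (- y) ^ n)"

lemma summable_norm_log1p:
  fixes y :: "'a::{real_normed_algebra_1,banach}"
  assumes "norm y < 1"
  shows "summable (\<lambda>n. norm (((-1) ^ n / real (Suc n)) *\<^sub>R y ^ Suc n))"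
proof (rule summable_comparison_test')
  show "summable (\<lambda>n. norm y ^ n)"
    using assms by (simp add: summable_geometric)
  fix n :: nat
  have "norm (((-1) ^ n / real (Suc n)) *\<^sub>R y ^ Suc n) \<le> norm (y ^ Suc n)"
    by (simp add: divide_simps mult_left_le power_abs mult_le_cancel_left1 del: power_Suc)
  also have "\<dots> \<le> norm y ^ Suc n" by (rule norm_power_ineq)
  also have "\<dots> \<le> norm y ^ n" using assms by (simp add: mult_left_le_one_le)
  finally show "norm (norm (((-1) ^ n / real (Suc n)) *\<^sub>R y ^ Suc n)) \<le> norm y ^ n" by simp
qed

lemmas summable_log1p = summable_norm_log1p[THEN summable_norm_cancel]

lemma log1p_intertwine:
  fixes a x y :: "'a::{real_normed_algebra_1,banach}"
  assumes "a * x = y * a" "norm x < 1" "norm y < 1"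
  shows "a * log1p x = log1p y * a"
proof -
  have "a * log1p x = (\<Sum>n. a * (((-1) ^ n / real (Suc n)) *\<^sub>R x ^ Suc n))"
    unfolding log1p_def by (rule suminf_mult[symmetric]) (rule summable_log1p[OF assms(2)])
  also have "\<dots> = (\<Sum>n. (((-1) ^ n / real (Suc n)) *\<^sub>R y ^ Suc n) * a)"
    by (simp only: mult_scaleR_right mult_scaleR_left power_intertwine[OF assms(1)])
  also have "\<dots> = log1p y * a"
    unfolding log1p_def by (rule suminf_mult2[symmetric]) (rule summable_log1p[OF assms(3)])
  finally show ?thesis .
qed

lemma neumann_inverse:
  fixes y :: "'a::{real_normed_algebra_1,banach}"
  assumes "norm y < 1"
  shows "(1 + y) * neumann y = 1" and "neumann y * (1 + y) = 1"
proof -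
  have summ: "summable (\<lambda>n. (- y) ^ n)"
    using assms by (intro complete_algebra_summable_geometric) simp
  have "neumann y = 1 + (\<Sum>n. (- y) ^ Suc n)"
    unfolding neumann_def using suminf_split_head[OF summ] by simp
  moreover have "(\<Sum>n. (- y) ^ Suc n) = - y * neumann y"
    unfolding neumann_def using suminf_mult[OF summ, of "- y"] by simp
  moreover have "(\<Sum>n. (- y) ^ Suc n) = neumann y * (- y)"
    unfolding neumann_def suminf_mult2[OF summ, of "- y"] power_Suc2 ..
  ultimately show "(1 + y) * neumann y = 1" "neumann y * (1 + y) = 1"
    by (simp_all add: algebra_simps)
qed

lemma log1p_0 [simp]: "log1p 0 = 0"
  by (simp add: log1p_def)

lemma norm_scaleR_unit_less:
  fixes y :: "'a::real_normed_vector"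
  assumes "norm y < 1" "t \<in> {0..1::real}"
  shows "norm (t *\<^sub>R y) < 1"
proof -
  have "norm (t *\<^sub>R y) \<le> norm y"
    using assms by (simp add: mult_left_le_one_le)
  then show ?thesis using assms by simp
qed

text \<open>
Differentiation term by term of the logarithmic series along the segment from 0 to \<open>y\<close>: the
differentiated series is a geometric one, dominated by \<open>\<parallel>y\<parallel>^n\<close> uniformly up to both end points.
\<close>

lemma log1p_has_vector_derivative:
  fixes y :: "'a::{real_normed_algebra_1,banach}"
  assumes y: "norm y < 1" and t: "t \<in> {0..1}"
  shows "((\<lambda>s. log1p (s *\<^sub>R y)) has_vector_derivative y * neumann (t *\<^sub>R y)) (at t within {0..1})"
proof -
  define f where "f n s = ((-1) ^ n / real (Suc n)) *\<^sub>R (s *\<^sub>R y) ^ Suc n" for n and s :: real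
  define a where "a n s = y * (- (s *\<^sub>R y)) ^ n" for n and s :: real
  have f_der: "(f n has_derivative (\<lambda>h. h *\<^sub>R a n s)) (at s within {0..1})" for n s
  proof -
    have "((\<lambda>s. ((-1) ^ n / real (Suc n) * s ^ Suc n) *\<^sub>R y ^ Suc n) has_vector_derivative
        ((-1) ^ n * s ^ n) *\<^sub>R y ^ Suc n) (at s within {0..1})"
      by (rule derivative_eq_intros refl | simp add: field_simps)+
    moreover have "((-1) ^ n * s ^ n) *\<^sub>R y ^ Suc n = a n s"
      unfolding a_def scaleR_minus_left[symmetric] scaleR_power power_minus[of s] by simp
    moreover have "f n = (\<lambda>s. ((-1) ^ n / real (Suc n) * s ^ Suc n) *\<^sub>R y ^ Suc n)"
      by (simp add: f_def fun_eq_iff)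
    ultimately show ?thesis by (simp only: has_vector_derivative_def)
  qed
  have "uniform_limit {0..1} (\<lambda>n s. \<Sum>i<n. a i s) (\<lambda>s. \<Sum>i. a i s) sequentially"
  proof (rule Weierstrass_m_test)
    show "summable (\<lambda>n. norm y * norm y ^ n)"
      using y by (intro summable_mult summable_geometric) simp
    fix n and s :: real assume s: "s \<in> {0..1}"
    have "norm (a n s) \<le> norm y * norm ((- (s *\<^sub>R y)) ^ n)"
      unfolding a_def by (rule norm_mult_ineq)
    also have "\<dots> \<le> norm y * norm (s *\<^sub>R y) ^ n"
      using norm_power_ineq[of "- (s *\<^sub>R y)" n] by (simp add: mult_left_mono)
    also have "\<dots> \<le> norm y * norm y ^ n"
      using s by (intro mult_left_mono power_mono) (simp_all add: mult_left_le_one_le)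
    finally show "norm (a n s) \<le> norm y * norm y ^ n" .
  qed
  moreover have "(\<Sum>i. a i s) = y * neumann (s *\<^sub>R y)" if "s \<in> {0..1}" for s
    unfolding a_def neumann_def using norm_scaleR_unit_less[OF y that]
    by (intro suminf_mult complete_algebra_summable_geometric) simp
  ultimately have unif: "uniform_limit {0..1} (\<lambda>n s. \<Sum>i<n. a i s) (\<lambda>s. y * neumann (s *\<^sub>R y)) sequentially"
    by (subst uniform_limit_cong'[where g = "\<lambda>n s. \<Sum>i<n. a i s" and i = "\<lambda>s. \<Sum>i. a i s"]) simp_all
  have "\<exists>g. \<forall>s\<in>{0..1}. (\<lambda>n. f n s) sums g s \<and>
      (g has_derivative (\<lambda>h. h *\<^sub>R (y * neumann (s *\<^sub>R y)))) (at s within {0..1})"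
  proof (rule has_derivative_series[OF _ f_der])
    show "\<forall>\<^sub>F n in sequentially. \<forall>s\<in>{0..1}. \<forall>h.
        norm ((\<Sum>i<n. h *\<^sub>R a i s) - h *\<^sub>R (y * neumann (s *\<^sub>R y))) \<le> e * norm h" if "e > 0" for e
      using uniform_limitD[OF unif that]
    proof (rule eventually_mono, safe)
      fix n s h
      assume "\<forall>s\<in>{0..1}. dist (\<Sum>i<n. a i s) (y * neumann (s *\<^sub>R y)) < e" "s \<in> {0..1::real}"
      then have "norm ((\<Sum>i<n. a i s) - y * neumann (s *\<^sub>R y)) \<le> e"
        by (auto simp: dist_norm intro: less_imp_le)
      moreover have "(\<Sum>i<n. h *\<^sub>R a i s) - h *\<^sub>R (y * neumann (s *\<^sub>R y))
          = h *\<^sub>R ((\<Sum>i<n. a i s) - y * neumann (s *\<^sub>R y))"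
        by (simp add: scaleR_right_diff_distrib scaleR_right.sum)
      ultimately show "norm ((\<Sum>i<n. h *\<^sub>R a i s) - h *\<^sub>R (y * neumann (s *\<^sub>R y))) \<le> e * norm h"
        by (simp add: mult.commute[of e] mult_left_mono)
    qed
    show "(\<lambda>n. f n 0) sums 0" by (simp add: f_def)
  qed auto
  then obtain g where g: "\<And>s. s \<in> {0..1} \<Longrightarrow> (\<lambda>n. f n s) sums g s"
    "(g has_derivative (\<lambda>h. h *\<^sub>R (y * neumann (t *\<^sub>R y)))) (at t within {0..1})"
    using t by blast
  have "g s = log1p (s *\<^sub>R y)" if "s \<in> {0..1}" for s
    using sums_unique[OF g(1)[OF that]] by (simp add: log1p_def f_def)
  then show ?thesis
    unfolding has_vector_derivative_def by (intro has_derivative_transform[OF t _ g(2)]) simp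
qed

lemma constant_on_unit_interval:
  fixes G :: "real \<Rightarrow> 'a::real_normed_vector"
  assumes "\<And>t. t \<in> {0..1} \<Longrightarrow> (G has_vector_derivative 0) (at t within {0..1})"
  shows "G 1 = G 0"
proof -
  obtain c where "\<And>t. t \<in> {0..1} \<Longrightarrow> G t = c"
    using has_vector_derivative_zero_constant[of "{0..1}" G] assms by auto
  then show ?thesis by simp
qed

text \<open>
The path \<open>exp (- log1p (t y)) (1 + t y)\<close> has derivative 0 and starts at 1.
\<close>

theorem exp_log1p:
  fixes y :: "'a::{real_normed_algebra_1,banach}"
  assumes y: "norm y < 1"
  shows "exp (log1p y) = 1 + y"
proof -
  define G where "G t = exp (- log1p (t *\<^sub>R y)) * (1 + t *\<^sub>R y)" for t :: real
  have comm: "log1p (s *\<^sub>R y) * log1p (t *\<^sub>R y) = log1p (t *\<^sub>R y) * log1p (s *\<^sub>R y)"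
    if "s \<in> {0..1}" "t \<in> {0..1}" for s t
  proof -
    have "(t *\<^sub>R y) * log1p (s *\<^sub>R y) = log1p (s *\<^sub>R y) * (t *\<^sub>R y)"
      using norm_scaleR_unit_less[OF y that(1)] by (intro log1p_intertwine) auto
    then show ?thesis
      using norm_scaleR_unit_less[OF y that(2)] by (intro log1p_intertwine) auto
  qed
  have "(G has_vector_derivative 0) (at t within {0..1})" if t: "t \<in> {0..1}" for t
  proof -
    let ?N = "neumann (t *\<^sub>R y)"
    have "((\<lambda>s. exp (- log1p (s *\<^sub>R y))) has_vector_derivative
        exp (- log1p (t *\<^sub>R y)) * - (y * ?N)) (at t within {0..1})"
      using t comm[OF _ t]
      by (intro exp_commuting_has_vector_derivative has_vector_derivative_minus
          log1p_has_vector_derivative[OF y]) auto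
    then have "(G has_vector_derivative exp (- log1p (t *\<^sub>R y)) * y
        + exp (- log1p (t *\<^sub>R y)) * - (y * ?N) * (1 + t *\<^sub>R y)) (at t within {0..1})"
      unfolding G_def
      by (intro has_vector_derivative_mult) (auto intro!: derivative_eq_intros)
    moreover have "exp (- log1p (t *\<^sub>R y)) * - (y * ?N) * (1 + t *\<^sub>R y) = - (exp (- log1p (t *\<^sub>R y)) * y)"
      using neumann_inverse(2)[OF norm_scaleR_unit_less[OF y t]] by (simp add: mult.assoc)
    ultimately show ?thesis by simp
  qed
  then have "G 1 = G 0" by (rule constant_on_unit_interval)
  then have "exp (- log1p y) * (1 + y) = 1" by (simp add: G_def)
  then have "exp (log1p y) * (exp (- log1p y) * (1 + y)) = exp (log1p y)" by simp
  then show ?thesis by (simp add: mult.assoc[symmetric] exp_minus_inverse)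
qed

text \<open>
The obvious path \<open>log1p\<close> of \<open>inverse (1 + t y) - 1\<close> may leave the unit ball, where the series need not
converge. Instead the two logarithms run along the segments to \<open>y\<close> and from \<open>y'\<close> in opposite
directions. From \<open>(1 + y) (1 + (1 - t) y') = 1 + t y\<close> one finds that their derivatives agree, so that
\<open>log1p (t y) - log1p ((1 - t) y')\<close> is constant; its end values are \<open>log1p y\<close> and \<open>- log1p y'\<close>.
\<close>

theorem log1p_inverse:
  fixes y y' :: "'a::{real_normed_algebra_1,banach}"
  assumes y: "norm y < 1" and y': "norm y' < 1"
    and inv: "(1 + y) * (1 + y') = 1" "(1 + y') * (1 + y) = 1"
  shows "log1p y' = - log1p y"
proof -
  define G where "G t = log1p (t *\<^sub>R y) - log1p ((1 - t) *\<^sub>R y')" for t :: real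
  have "(G has_vector_derivative 0) (at t within {0..1})" if t: "t \<in> {0..1}" for t
  proof -
    let ?N = "neumann (t *\<^sub>R y)" and ?N' = "neumann ((1 - t) *\<^sub>R y')"
    have t': "1 - t \<in> {0..1}" using t by auto
    have "((\<lambda>s. log1p (s *\<^sub>R y')) \<circ> (\<lambda>s. 1 - s) has_vector_derivative (- 1) *\<^sub>R (y' * ?N')) (at t within {0..1})"
    proof (rule vector_diff_chain_within)
      show "((\<lambda>s. 1 - s) has_vector_derivative - 1) (at t within {0..1})"
        by (auto intro!: derivative_eq_intros)
      show "((\<lambda>s. log1p (s *\<^sub>R y')) has_vector_derivative y' * ?N') (at (1 - t) within (\<lambda>s. 1 - s) ` {0..1})"
        by (rule has_vector_derivative_within_subset[OF log1p_has_vector_derivative[OF y' t']]) auto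
    qed
    then have "(G has_vector_derivative y * ?N - (- 1) *\<^sub>R (y' * ?N')) (at t within {0..1})"
      unfolding G_def o_def
      by (intro has_vector_derivative_diff log1p_has_vector_derivative[OF y t])
    moreover have "y * ?N + y' * ?N' = 0"
    proof -
      note N = neumann_inverse[OF norm_scaleR_unit_less[OF y t]]
      note N' = neumann_inverse[OF norm_scaleR_unit_less[OF y' t']]
      have P: "(1 + y) * (1 + (1 - t) *\<^sub>R y') = 1 + t *\<^sub>R y"
      proof -
        have "1 + (1 - t) *\<^sub>R y' = t *\<^sub>R 1 + (1 - t) *\<^sub>R (1 + y')"
          by (simp add: algebra_simps)
        then have "(1 + y) * (1 + (1 - t) *\<^sub>R y') = t *\<^sub>R (1 + y) + (1 - t) *\<^sub>R ((1 + y) * (1 + y'))"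
          by (simp only: distrib_left mult_scaleR_right mult_1_right)
        also have "\<dots> = 1 + t *\<^sub>R y"
          unfolding inv(1) by (simp add: algebra_simps)
        finally show ?thesis .
      qed
      have N'_eq: "?N' = ?N * (1 + y)"
      proof -
        have "?N * (1 + y) * ((1 + (1 - t) *\<^sub>R y') * ?N') = ?N * ((1 + y) * (1 + (1 - t) *\<^sub>R y')) * ?N'"
          by (simp only: mult.assoc)
        then show ?thesis using N N' P by simp
      qed
      have comm: "?N * (1 + y) = (1 + y) * ?N"
      proof -
        have "?N * (1 + y) = ?N * (1 + y) * ((1 + t *\<^sub>R y) * ?N)" using N by simp
        also have "\<dots> = ?N * ((1 + y) * (1 + t *\<^sub>R y)) * ?N" by (simp only: mult.assoc)
        also have "(1 + y) * (1 + t *\<^sub>R y) = (1 + t *\<^sub>R y) * (1 + y)" by (simp add: algebra_simps)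
        also have "?N * ((1 + t *\<^sub>R y) * (1 + y)) * ?N = (?N * (1 + t *\<^sub>R y)) * ((1 + y) * ?N)"
          by (simp only: mult.assoc)
        finally show ?thesis using N by simp
      qed
      have "y' * ?N' = y' * (1 + y) * ?N" by (simp only: N'_eq comm mult.assoc)
      also have "y' * (1 + y) = - y"
        unfolding eq_neg_iff_add_eq_0 using inv(2) by (simp add: algebra_simps)
      finally show ?thesis by simp
    qed
    ultimately show ?thesis by simp
  qed
  then have "G 1 = G 0" by (rule constant_on_unit_interval)
  then show ?thesis by (simp add: G_def)
qed

section \<open>Bounded operators inside a unital Banach algebra\<close>

text \<open>
The results above need an algebra whose unit has norm 1, and the identity operator on the zero space
has norm 0. The product of the operators with the scalars, under the maximum norm, satisfies this on
every space, and its first projection \<open>of_alg\<close> is a continuous unital homomorphism. Identities between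
power series in operators are obtained by lifting each operator along the (non-unital) section \<open>to_alg\<close>
and projecting the result.
\<close>

typedef (overloaded) 'a op_alg = "UNIV :: ((('a::complex_hilbert) \<Rightarrow>\<^sub>L 'a) \<times> real) set"
  morphisms op_alg_pair Op_alg ..

setup_lifting type_definition_op_alg

instantiation op_alg :: (complex_hilbert) scaleR
begin

lift_definition scaleR_op_alg :: "real \<Rightarrow> 'a op_alg \<Rightarrow> 'a op_alg"
  is "\<lambda>r x. (r *\<^sub>R fst x, r * snd x)" .

instance ..

end

instantiation op_alg :: (complex_hilbert) real_normed_algebra_1
begin

lift_definition zero_op_alg :: "'a op_alg" is "(0, 0)" .
lift_definition one_op_alg :: "'a op_alg" is "(id_blinfun, 1)" .
lift_definition plus_op_alg :: "'a op_alg \<Rightarrow> 'a op_alg \<Rightarrow> 'a op_alg"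
  is "\<lambda>x y. (fst x + fst y, snd x + snd y)" .
lift_definition minus_op_alg :: "'a op_alg \<Rightarrow> 'a op_alg \<Rightarrow> 'a op_alg"
  is "\<lambda>x y. (fst x - fst y, snd x - snd y)" .
lift_definition uminus_op_alg :: "'a op_alg \<Rightarrow> 'a op_alg" is "\<lambda>x. (- fst x, - snd x)" .
lift_definition times_op_alg :: "'a op_alg \<Rightarrow> 'a op_alg \<Rightarrow> 'a op_alg"
  is "\<lambda>x y. (fst x o\<^sub>L fst y, snd x * snd y)" .
lift_definition norm_op_alg :: "'a op_alg \<Rightarrow> real" is "\<lambda>x. max (norm (fst x)) \<bar>snd x\<bar>" .

definition dist_op_alg :: "'a op_alg \<Rightarrow> 'a op_alg \<Rightarrow> real"
  where "dist_op_alg x y = norm (x - y)"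
definition sgn_op_alg :: "'a op_alg \<Rightarrow> 'a op_alg"
  where "sgn_op_alg x = x /\<^sub>R norm x"
definition uniformity_op_alg :: "('a op_alg \<times> 'a op_alg) filter"
  where "uniformity_op_alg = (INF e\<in>{0<..}. principal {(x, y). dist x y < e})"
definition open_op_alg :: "'a op_alg set \<Rightarrow> bool"
  where "open_op_alg S \<longleftrightarrow> (\<forall>x\<in>S. \<forall>\<^sub>F (x', y) in uniformity. x' = x \<longrightarrow> y \<in> S)"

instance
proof
  fix x y z :: "'a op_alg" and r s :: real
  show "norm (x + y) \<le> norm x + norm y"
    by transfer (auto simp: max_def intro: order_trans[OF norm_triangle_ineq] order_trans[OF abs_triangle_ineq])
  show "norm (x * y) \<le> norm x * norm y"
  proof transfer
    fix x y :: "('a \<Rightarrow>\<^sub>L 'a) \<times> real"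
    have "norm (fst x o\<^sub>L fst y) \<le> norm (fst x) * norm (fst y)" by (rule norm_blinfun_compose)
    also have "\<dots> \<le> max (norm (fst x)) \<bar>snd x\<bar> * max (norm (fst y)) \<bar>snd y\<bar>"
      by (intro mult_mono) auto
    finally show "max (norm (fst (fst x o\<^sub>L fst y, snd x * snd y))) \<bar>snd (fst x o\<^sub>L fst y, snd x * snd y)\<bar>
        \<le> max (norm (fst x)) \<bar>snd x\<bar> * max (norm (fst y)) \<bar>snd y\<bar>"
      by (auto simp: abs_mult intro: mult_mono)
  qed
  show "norm (r *\<^sub>R x) = \<bar>r\<bar> * norm x"
    by transfer (auto simp: abs_mult max_def mult_le_cancel_left)
  show "(norm x = 0) = (x = 0)"
    by transfer (auto simp: max_def prod_eq_iff)
  show "norm (1 :: 'a op_alg) = 1"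
    by transfer (simp add: max_def norm_blinfun_id_le order_antisym)
  show "(0 :: 'a op_alg) \<noteq> 1" by transfer simp
  show "dist x y = norm (x - y)" by (rule dist_op_alg_def)
  show "sgn x = x /\<^sub>R norm x" by (rule sgn_op_alg_def)
  show "uniformity = (INF e\<in>{0<..}. principal {(x, y :: 'a op_alg). dist x y < e})"
    by (rule uniformity_op_alg_def)
  show "open U \<longleftrightarrow> (\<forall>x\<in>U. \<forall>\<^sub>F (x', y) in uniformity. x' = x \<longrightarrow> y \<in> U)" for U :: "'a op_alg set"
    by (rule open_op_alg_def)
qed (transfer; auto simp: algebra_simps blinfun.bilinear_simps intro!: blinfun_eqI; fail)+

end

definition of_alg :: "'a::complex_hilbert op_alg \<Rightarrow> 'a \<Rightarrow>\<^sub>L 'a"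
  where "of_alg x = fst (op_alg_pair x)"

definition to_alg :: "'a::complex_hilbert \<Rightarrow>\<^sub>L 'a \<Rightarrow> 'a op_alg"
  where "to_alg B = Op_alg (B, 0)"

definition alg_scalar :: "'a::complex_hilbert op_alg \<Rightarrow> real"
  where "alg_scalar x = snd (op_alg_pair x)"

lemmas op_alg_rep_eqs = zero_op_alg.rep_eq one_op_alg.rep_eq plus_op_alg.rep_eq
  minus_op_alg.rep_eq uminus_op_alg.rep_eq times_op_alg.rep_eq scaleR_op_alg.rep_eq

lemma norm_op_alg_eq: "norm x = max (norm (of_alg x)) \<bar>alg_scalar x\<bar>"
  by (simp add: norm_op_alg.rep_eq of_alg_def alg_scalar_def)

lemma of_to_alg [simp]: "of_alg (to_alg B) = B"
  by (simp add: of_alg_def to_alg_def Op_alg_inverse)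

lemma norm_to_alg [simp]: "norm (to_alg B) = norm B"
  by (simp add: norm_op_alg.rep_eq to_alg_def Op_alg_inverse)

lemma of_alg_simps [simp]:
  "of_alg 1 = id_blinfun" "of_alg (x * y) = of_alg x o\<^sub>L of_alg y"
  "of_alg 0 = 0" "of_alg (x + y) = of_alg x + of_alg y" "of_alg (x - y) = of_alg x - of_alg y"
  "of_alg (- x) = - of_alg x" "of_alg (r *\<^sub>R x) = r *\<^sub>R of_alg x"
  by (simp_all add: of_alg_def op_alg_rep_eqs)

lemma bounded_linear_of_alg: "bounded_linear of_alg"
  by (rule bounded_linear_intro[of _ 1]) (auto simp: norm_op_alg_eq)

instance op_alg :: (complex_hilbert) banach
proof
  fix X :: "nat \<Rightarrow> 'a op_alg" assume X: "Cauchy X"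
  have scalar: "bounded_linear (alg_scalar :: 'a op_alg \<Rightarrow> real)"
    by (rule bounded_linear_intro[of _ 1]) (auto simp: norm_op_alg_eq alg_scalar_def op_alg_rep_eqs)
  have "Cauchy (\<lambda>n. of_alg (X n))" "Cauchy (\<lambda>n. alg_scalar (X n))"
    using X by (auto intro: bounded_linear.Cauchy bounded_linear_of_alg scalar)
  then obtain B r where lim: "(\<lambda>n. of_alg (X n)) \<longlonglongrightarrow> B" "(\<lambda>n. alg_scalar (X n)) \<longlonglongrightarrow> r"
    by (auto simp: Cauchy_convergent_iff convergent_def)
  define x where "x = Op_alg (B, r)"
  have x: "of_alg x = B" "alg_scalar x = r"
    by (simp_all add: x_def of_alg_def alg_scalar_def Op_alg_inverse)
  have "(\<lambda>n. norm (X n - x)) \<longlonglongrightarrow> max 0 0"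
  proof -
    have "(\<lambda>n. max (norm (of_alg (X n) - B)) \<bar>alg_scalar (X n) - r\<bar>) \<longlonglongrightarrow> max 0 0"
      using lim by (intro tendsto_max) (auto simp: LIM_zero_iff tendsto_norm_zero_iff tendsto_rabs_zero_iff)
    then show ?thesis
      by (simp add: norm_op_alg_eq x linear_diff[OF bounded_linear.linear[OF scalar]])
  qed
  then have "X \<longlonglongrightarrow> x" by (simp add: LIM_zero_iff tendsto_norm_zero_iff)
  then show "convergent X" by (auto simp: convergent_def)
qed

lemma op_power_0 [simp]: "op_power B 0 = id_blinfun"
  and op_power_Suc [simp]: "op_power B (Suc n) = B o\<^sub>L op_power B n"
  by (simp_all add: op_power_def)

lemma of_alg_power: "of_alg (x ^ n) = op_power (of_alg x) n"
  by (induction n) simp_all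

definition op_log1p :: "'a::complex_hilbert op \<Rightarrow> 'a op"
  where "op_log1p B = (\<Sum>n. ((-1) ^ n / real (Suc n)) *\<^sub>R op_power B (Suc n))"

lemma
  shows of_alg_exp: "of_alg (exp x) = op_exp (of_alg x)"
    and of_alg_exp_sums: "(\<lambda>n. (1 / fact n) *\<^sub>R op_power (of_alg x) n) sums of_alg (exp x)"
proof -
  show sums: "(\<lambda>n. (1 / fact n) *\<^sub>R op_power (of_alg x) n) sums of_alg (exp x)"
    using bounded_linear.sums[OF bounded_linear_of_alg exp_converges[of x]]
    by (simp add: of_alg_power divide_inverse)
  then show "of_alg (exp x) = op_exp (of_alg x)"
    unfolding op_exp_def by (rule sums_unique)
qed

lemma op_exp_sums: "(\<lambda>n. (1 / fact n) *\<^sub>R op_power B n) sums op_exp B"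
  using of_alg_exp_sums[of "to_alg B"] of_alg_exp[of "to_alg B"] by simp

lemma
  assumes "norm x < 1"
  shows of_alg_log1p: "of_alg (log1p x) = op_log1p (of_alg x)"
    and of_alg_log1p_sums: "(\<lambda>n. ((-1) ^ n / real (Suc n)) *\<^sub>R op_power (of_alg x) (Suc n)) sums of_alg (log1p x)"
proof -
  have "(\<lambda>n. ((-1) ^ n / real (Suc n)) *\<^sub>R x ^ Suc n) sums log1p x"
    unfolding log1p_def by (rule summable_sums[OF summable_log1p[OF assms]])
  then show *: "(\<lambda>n. ((-1) ^ n / real (Suc n)) *\<^sub>R op_power (of_alg x) (Suc n)) sums of_alg (log1p x)"
    using bounded_linear.sums[OF bounded_linear_of_alg]
    by (fastforce simp: of_alg_power simp del: power_Suc op_power_Suc)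
  then show "of_alg (log1p x) = op_log1p (of_alg x)"
    unfolding op_log1p_def by (rule sums_unique)
qed

lemma op_log1p_sums:
  assumes "norm B < 1"
  shows "(\<lambda>n. ((-1) ^ n / real (Suc n)) *\<^sub>R op_power B (Suc n)) sums op_log1p B"
  using of_alg_log1p_sums[of "to_alg B"] of_alg_log1p[of "to_alg B"] assms
  by (simp del: op_power_Suc)

section \<open>Complex Hilbert spaces and adjoints\<close>

lemma cinner_scaleC_right: "cinner x (c *\<^sub>C y) = cnj c * cinner x y"
  for x y :: "'a::complex_hilbert"
  by (metis cinner_commute cinner_scaleC_left complex_cnj_mult)

text \<open>
The complex inner product is recovered from the real one, so for complex-linear operators it is
enough to compare real inner products.
\<close>

lemma cinner_eq_Complex: "cinner x y = Complex (inner x y) (inner x (\<i> *\<^sub>C y))"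
  for x y :: "'a::complex_hilbert"
  by (simp add: complex_eq_iff inner_eq_Re_cinner cinner_scaleC_right)

lemma inner_scaleC_left: "inner (c *\<^sub>C x) y = inner x (cnj c *\<^sub>C y)"
  for x y :: "'a::complex_hilbert"
  by (simp add: inner_eq_Re_cinner cinner_scaleC_left cinner_scaleC_right)

lemma scaleC_one [simp]: "1 *\<^sub>C x = x" for x :: "'a::complex_hilbert"
  using scaleR_scaleC[of 1 x] by simp

lemma norm_scaleC: "norm (c *\<^sub>C x) = cmod c * norm x" for x :: "'a::complex_hilbert"
proof -
  have "inner (c *\<^sub>C x) (c *\<^sub>C x) = (cmod c)\<^sup>2 * inner x x"
    by (simp add: inner_scaleC_left scaleC_scaleC mult.commute[of "cnj c"]
        complex_norm_square[symmetric] flip: scaleR_scaleC of_real_power)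
  then show ?thesis
    by (simp add: norm_eq_sqrt_inner real_sqrt_mult)
qed

lemma bounded_linear_scaleC_right: "bounded_linear (\<lambda>x::'a::complex_hilbert. c *\<^sub>C x)"
proof (rule bounded_linear_intro[of _ "cmod c"])
  show "c *\<^sub>C r *\<^sub>R x = r *\<^sub>R c *\<^sub>C x" for r and x :: 'a
    by (simp add: scaleR_scaleC scaleC_scaleC mult.commute)
qed (simp_all add: scaleC_add_right norm_scaleC mult.commute)

lemma scaleC_diff_left: "(a - b) *\<^sub>C x = a *\<^sub>C x - b *\<^sub>C x" for x :: "'a::complex_hilbert"
  using scaleC_add_left[of "a - b" b x] by simp

lemma scaleC_diff_right: "c *\<^sub>C (x - y) = c *\<^sub>C x - c *\<^sub>C y" for x :: "'a::complex_hilbert"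
  using scaleC_add_right[of c "x - y" y] by simp

lemma scaleC_zero_right [simp]: "c *\<^sub>C 0 = (0 :: 'a::complex_hilbert)"
  using linear_0[OF bounded_linear.linear[OF bounded_linear_scaleC_right]] .

lemma scaleC_zero_left [simp]: "0 *\<^sub>C x = (0 :: 'a::complex_hilbert)"
  using scaleR_scaleC[of 0 x] by simp

lemma scaleC_minus_left: "(- c) *\<^sub>C x = - (c *\<^sub>C x)" for x :: "'a::complex_hilbert"
  using scaleC_diff_left[of 0 c x] by simp

lemma bounded_opsD: "B \<in> bounded_ops \<Longrightarrow> blinfun_apply B (c *\<^sub>C f) = c *\<^sub>C blinfun_apply B f"
  by (simp add: bounded_ops_def)

lemma bounded_ops_id [simp]: "id_blinfun \<in> bounded_ops"
  and bounded_ops_compose: "B \<in> bounded_ops \<Longrightarrow> C \<in> bounded_ops \<Longrightarrow> B o\<^sub>L C \<in> bounded_ops"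
  by (simp_all add: bounded_ops_def)

lemma subspace_bounded_ops: "subspace (bounded_ops :: 'a::complex_hilbert op set)"
  unfolding subspace_def bounded_ops_def
  using bounded_linear_scaleC_right[where 'a = 'a]
  by (auto simp: blinfun.bilinear_simps scaleC_add_right
      linear_0[OF bounded_linear.linear] linear_scale[OF bounded_linear.linear])

lemma closed_bounded_ops: "closed (bounded_ops :: 'a::complex_hilbert op set)"
proof -
  have "closed {B :: 'a op. blinfun_apply B (c *\<^sub>C f) = c *\<^sub>C blinfun_apply B f}" for c f
    by (intro closed_Collect_eq continuous_intros
        bounded_linear.continuous_on[OF bounded_linear_scaleC_right])
  then have "closed (\<Inter>c f. {B :: 'a op. blinfun_apply B (c *\<^sub>C f) = c *\<^sub>C blinfun_apply B f})"
    by blast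
  also have "(\<Inter>c f. {B :: 'a op. blinfun_apply B (c *\<^sub>C f) = c *\<^sub>C blinfun_apply B f}) = bounded_ops"
    by (auto simp: bounded_ops_def)
  finally show ?thesis .
qed

lemmas bounded_ops_add = subspace_add[OF subspace_bounded_ops]
  and bounded_ops_diff = subspace_diff[OF subspace_bounded_ops]
  and bounded_ops_scaleR = subspace_scale[OF subspace_bounded_ops]
  and bounded_ops_minus = subspace_neg[OF subspace_bounded_ops]

text \<open>
The representing vector is the minimiser of \<open>\<parallel>x\<parallel>\<^sup>2 / 2 - F x\<close>. By the parallelogram identity every
minimising sequence is Cauchy, and the first variation at the minimiser is the claim.
\<close>

lemma riesz_representation:
  fixes F :: "'a::{real_inner, banach} \<Rightarrow> real"
  assumes F: "bounded_linear F"
  shows "\<exists>x. \<forall>y. F y = inner x y"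
proof -
  interpret F: bounded_linear F by (rule F)
  define g where "g x = (norm x)\<^sup>2 / 2 - F x" for x
  obtain K where K: "\<And>x. \<bar>F x\<bar> \<le> norm x * K"
    using F.bounded by auto
  have lower: "- K\<^sup>2 / 2 \<le> g x" for x
  proof -
    have "0 \<le> (norm x - K)\<^sup>2" by simp
    then show ?thesis using K[of x] by (simp add: g_def power2_diff algebra_simps abs_le_iff)
  qed
  define m where "m = Inf (range g)"
  have bdd: "bdd_below (range g)" by (rule bdd_belowI2[OF lower])
  have m_le: "m \<le> g x" for x unfolding m_def by (intro cInf_lower bdd) simp
  have "\<exists>x. g x < m + 1 / real (Suc n)" for n
    using cInf_lessD[of "range g" "m + 1 / real (Suc n)"] unfolding m_def by auto
  then obtain x where x: "\<And>n. g (x n) < m + 1 / real (Suc n)" by metis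
  have parallelogram: "g ((1/2) *\<^sub>R (u + v)) = (g u + g v) / 2 - (norm (u - v))\<^sup>2 / 8" for u v
    unfolding g_def power2_norm_eq_inner
    by (simp add: F.add F.scaleR inner_simps inner_commute field_simps)
  have close: "(norm (x i - x j))\<^sup>2 \<le> 4 * (1 / real (Suc i)) + 4 * (1 / real (Suc j))" for i j
  proof -
    have "d \<le> 4 * a + 4 * b" if "u < m + a" "v < m + b" "m \<le> (u + v) / 2 - d / 8" for a b u v d :: real
      using that by (simp add: field_simps)
    from this[OF x x] m_le[of "(1/2) *\<^sub>R (x i + x j)"] show ?thesis
      unfolding parallelogram by blast
  qed
  have "Cauchy x"
  proof (rule metric_CauchyI)
    fix e :: real assume "e > 0"
    then obtain N where N: "1 / real (Suc N) < e\<^sup>2 / 8"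
      using nat_approx_posE[of "e\<^sup>2 / 8"] by auto
    have "dist (x i) (x j) < e" if "i \<ge> N" "j \<ge> N" for i j
    proof -
      have "1 / real (Suc i) \<le> 1 / real (Suc N)" "1 / real (Suc j) \<le> 1 / real (Suc N)"
        using that by (auto simp: frac_le)
      then have "(norm (x i - x j))\<^sup>2 < e\<^sup>2" using close[of i j] N by linarith
      then show ?thesis using \<open>e > 0\<close> by (simp add: dist_norm power2_less_imp_less)
    qed
    then show "\<exists>N. \<forall>i\<ge>N. \<forall>j\<ge>N. dist (x i) (x j) < e" by blast
  qed
  then obtain z where z: "x \<longlonglongrightarrow> z" by (auto simp: Cauchy_convergent_iff convergent_def)
  have "g z \<le> m"
  proof (rule LIMSEQ_le)
    show "(\<lambda>n. g (x n)) \<longlonglongrightarrow> g z"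
      unfolding g_def using z by (intro tendsto_intros F.tendsto) auto
    show "(\<lambda>n. m + 1 / real (Suc n)) \<longlonglongrightarrow> m"
      using tendsto_add[OF tendsto_const[of m] LIMSEQ_inverse_real_of_nat] by (simp add: inverse_eq_divide)
  qed (use x in \<open>auto intro: less_imp_le\<close>)
  have "F y = inner z y" for y
  proof (cases "y = 0")
    case False
    \<comment> \<open>The step \<open>- d / q\<close> minimises the quadratic polynomial \<open>s \<mapsto> g (z + s y)\<close>.\<close>
    define d where "d = inner z y - F y"
    define q where "q = inner y y"
    have q: "q > 0" using False by (simp add: q_def)
    have expand: "g (z + s *\<^sub>R y) = g z + s * d + s\<^sup>2 * q / 2" for s
      unfolding g_def power2_norm_eq_inner d_def q_def
      by (simp add: F.add F.scaleR inner_simps inner_commute power2_eq_square field_simps)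
    have "g z \<le> g (z + (- d / q) *\<^sub>R y)" using \<open>g z \<le> m\<close> m_le order_trans by blast
    also have "\<dots> = g z + (- d / q) * d + (- d / q)\<^sup>2 * q / 2" by (rule expand)
    also have "\<dots> = g z - d\<^sup>2 / (2 * q)" using q by (simp add: power2_eq_square field_simps)
    finally have "d\<^sup>2 / (2 * q) \<le> 0" by simp
    then have "d\<^sup>2 \<le> 0" using q by (simp add: divide_le_0_iff)
    then show ?thesis by (simp add: d_def)
  qed (simp add: F.zero)
  then show ?thesis by blast
qed

lemma adjoint_exists:
  assumes B: "B \<in> bounded_ops"
  shows "\<exists>C\<in>bounded_ops. \<forall>f g. cinner (blinfun_apply B f) g = cinner f (blinfun_apply C g)"
proof -
  have "\<exists>x. \<forall>f. inner (blinfun_apply B f) g = inner f x" for g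
  proof -
    have "bounded_linear (\<lambda>f. inner (blinfun_apply B f) g)"
      by (intro bounded_linear_compose[OF bounded_linear_inner_left] blinfun.bounded_linear_right)
    from riesz_representation[OF this] show ?thesis by (metis inner_commute)
  qed
  then obtain C where C: "\<And>f g. inner (blinfun_apply B f) g = inner f (C g)" by metis
  have eqI: "u = v" if "\<And>f. inner f u = inner f v" for u v :: 'a
    using that vector_eq_ldot by blast
  have C_scaleC: "C (c *\<^sub>C g) = c *\<^sub>C C g" for c g
  proof (rule eqI)
    fix f
    have "inner f (C (c *\<^sub>C g)) = inner (cnj c *\<^sub>C blinfun_apply B f) g"
      by (simp add: C[symmetric] inner_scaleC_left)
    also have "\<dots> = inner f (c *\<^sub>C C g)"
      by (simp add: bounded_opsD[OF B, symmetric] C inner_scaleC_left)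
    finally show "inner f (C (c *\<^sub>C g)) = inner f (c *\<^sub>C C g)" .
  qed
  have "bounded_linear C"
  proof (rule bounded_linear_intro[of _ "norm B"])
    show "C (g + h) = C g + C h" for g h
      by (rule eqI) (simp add: C[symmetric] inner_add_right)
    show "C (r *\<^sub>R g) = r *\<^sub>R C g" for r g
      by (simp add: scaleR_scaleC C_scaleC)
    show "norm (C g) \<le> norm g * norm B" for g
    proof (cases "C g = 0")
      case False
      have "norm (C g) * norm (C g) = inner (blinfun_apply B (C g)) g"
        by (simp add: C power2_norm_eq_inner flip: power2_eq_square)
      also have "\<dots> \<le> norm (blinfun_apply B (C g)) * norm g" by (rule norm_cauchy_schwarz)
      also have "\<dots> \<le> (norm B * norm (C g)) * norm g" by (intro mult_right_mono norm_blinfun) simp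
      finally show ?thesis using False by (simp add: mult_ac)
    qed simp
  qed
  then have app: "blinfun_apply (Blinfun C) = C" by (rule bounded_linear_Blinfun_apply)
  show ?thesis
  proof (intro bexI allI)
    show "Blinfun C \<in> bounded_ops" by (simp add: bounded_ops_def app C_scaleC)
    show "cinner (blinfun_apply B f) g = cinner f (blinfun_apply (Blinfun C) g)" for f g
      by (simp add: cinner_eq_Complex app C C_scaleC)
  qed
qed

lemma inner_adj_left:
  assumes "B \<in> bounded_ops"
  shows "inner (blinfun_apply (adj B) f) g = inner f (blinfun_apply B g)"
proof -
  have "adj B \<in> bounded_ops \<and> (\<forall>f g. cinner (blinfun_apply B f) g = cinner f (blinfun_apply (adj B) g))"
    unfolding adj_def
  proof (rule theI')
    show "\<exists>!C. C \<in> bounded_ops \<and> (\<forall>f g. cinner (blinfun_apply B f) g = cinner f (blinfun_apply C g))"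
    proof (rule ex_ex1I)
      show "\<exists>C. C \<in> bounded_ops \<and> (\<forall>f g. cinner (blinfun_apply B f) g = cinner f (blinfun_apply C g))"
        using adjoint_exists[OF assms] by blast
    next
      fix C D
      assume "C \<in> bounded_ops \<and> (\<forall>f g. cinner (blinfun_apply B f) g = cinner f (blinfun_apply C g))"
        and "D \<in> bounded_ops \<and> (\<forall>f g. cinner (blinfun_apply B f) g = cinner f (blinfun_apply D g))"
      then have "inner f (blinfun_apply C g) = inner f (blinfun_apply D g)" for f g
        by (metis inner_eq_Re_cinner)
      then show "C = D" by (metis vector_eq_ldot blinfun_eqI)
    qed
  qed
  then show ?thesis by (metis inner_eq_Re_cinner inner_commute)
qed

section \<open>The completion for the energy form\<close>

locale energy_completion =
  fixes A :: "'a::complex_hilbert op" and J :: "'a \<Rightarrow> 'b::complex_hilbert"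
  assumes A_bounded: "A \<in> bounded_ops" and completion: "hilbert_completion A J"
begin

lemma J_add: "J (f + g) = J f + J g"
  and J_scaleC: "J (c *\<^sub>C f) = c *\<^sub>C J f"
  and inner_J: "inner (J f) (J g) = inner (blinfun_apply A f) g"
  and J_dense: "closure (range J) = UNIV"
  using completion by (simp_all add: hilbert_completion_def inner_eq_Re_cinner)

lemma J_bounded_linear: "bounded_linear J"
proof (rule bounded_linear_intro[of _ "sqrt (norm A)"])
  show "J (r *\<^sub>R f) = r *\<^sub>R J f" for r f by (simp add: scaleR_scaleC J_scaleC)
  show "norm (J f) \<le> norm f * sqrt (norm A)" for f
  proof (rule power2_le_imp_le)
    have "(norm (J f))\<^sup>2 = inner (blinfun_apply A f) f" by (simp add: power2_norm_eq_inner inner_J)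
    also have "\<dots> \<le> norm (blinfun_apply A f) * norm f" by (rule norm_cauchy_schwarz)
    also have "\<dots> \<le> (norm A * norm f) * norm f" by (intro mult_right_mono norm_blinfun) simp
    finally show "(norm (J f))\<^sup>2 \<le> (norm f * sqrt (norm A))\<^sup>2"
      by (simp add: power_mult_distrib power2_eq_square mult_ac)
  qed simp
qed (rule J_add)

text \<open>
Closed conditions need only be checked on the range of \<open>J\<close>.
\<close>

lemma dense_induct:
  assumes "closed {x. P x}" and "\<And>f. P (J f)"
  shows "P x"
  using closure_minimal[of "range J" "{x. P x}"] assms J_dense by auto

text \<open>
Extension as a relation: it is compatible with all algebraic operations and with limits, also for
operators such as products of symmetric ones, for which an extension is not known to exist in advance.
\<close>

definition extends :: "'b op \<Rightarrow> 'a op \<Rightarrow> bool"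
  where "extends C B \<longleftrightarrow> C \<in> bounded_ops \<and> (\<forall>f. blinfun_apply C (J f) = J (blinfun_apply B f))"

lemma extendsD: "extends C B \<Longrightarrow> blinfun_apply C (J f) = J (blinfun_apply B f)"
  by (simp add: extends_def)

lemma extends_unique:
  assumes "extends C B" "extends D B"
  shows "C = D"
proof (rule blinfun_eqI)
  show "blinfun_apply C x = blinfun_apply D x" for x
    by (rule dense_induct[of "\<lambda>x. blinfun_apply C x = blinfun_apply D x"])
      (use assms in \<open>auto simp: extends_def intro!: closed_Collect_eq continuous_intros\<close>)
qed

lemma extension_eq: "extends C B \<Longrightarrow> extension J B = C"
  unfolding extension_def using extends_unique[of _ B]
  by (intro the_equality) (auto simp: extends_def)

lemma extends_id: "extends id_blinfun id_blinfun"
  by (simp add: extends_def)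

lemma extends_compose: "extends C B \<Longrightarrow> extends C' B' \<Longrightarrow> extends (C o\<^sub>L C') (B o\<^sub>L B')"
  by (simp add: extends_def bounded_ops_compose)

lemma extends_add: "extends C B \<Longrightarrow> extends C' B' \<Longrightarrow> extends (C + C') (B + B')"
  by (simp add: extends_def bounded_ops_add blinfun.add_left J_add)

lemma extends_scaleR: "extends C B \<Longrightarrow> extends (r *\<^sub>R C) (r *\<^sub>R B)"
  by (simp add: extends_def bounded_ops_scaleR blinfun.scaleR_left
      linear_scale[OF bounded_linear.linear[OF J_bounded_linear]])

lemma extends_minus: "extends C B \<Longrightarrow> extends (- C) (- B)"
  using extends_scaleR[of C B "-1"] by simp

lemma extends_diff: "extends C B \<Longrightarrow> extends C' B' \<Longrightarrow> extends (C - C') (B - B')"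
  using extends_add[OF _ extends_minus, of C B C' B'] by simp

lemma extends_zero: "extends 0 0"
  using extends_scaleR[OF extends_id, of 0] by simp

lemma extends_power: "extends C B \<Longrightarrow> extends (op_power C n) (op_power B n)"
  by (induction n) (simp_all add: extends_id extends_compose)

lemma extends_sum: "(\<And>i. i \<in> I \<Longrightarrow> extends (C i) (B i)) \<Longrightarrow> extends (\<Sum>i\<in>I. C i) (\<Sum>i\<in>I. B i)"
  by (induction I rule: infinite_finite_induct) (simp_all add: extends_zero extends_add)

lemma extends_limit:
  assumes "\<And>n. extends (C n) (B n)" and lim: "C \<longlonglongrightarrow> D" "B \<longlonglongrightarrow> E"
  shows "extends D E"
  unfolding extends_def
proof
  show "D \<in> bounded_ops"
    by (rule closed_sequentially[OF closed_bounded_ops _ lim(1)]) (use assms in \<open>simp add: extends_def\<close>)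
  show "\<forall>f. blinfun_apply D (J f) = J (blinfun_apply E f)"
  proof
    fix f
    have "(\<lambda>n. blinfun_apply (C n) (J f)) \<longlonglongrightarrow> blinfun_apply D (J f)"
      using lim by (intro tendsto_intros)
    moreover have "(\<lambda>n. J (blinfun_apply (B n) f)) \<longlonglongrightarrow> J (blinfun_apply E f)"
      using lim by (intro bounded_linear.tendsto[OF J_bounded_linear] tendsto_intros)
    ultimately show "blinfun_apply D (J f) = J (blinfun_apply E f)"
      unfolding extendsD[OF assms(1)] by (rule LIMSEQ_unique)
  qed
qed

lemma extends_sums:
  assumes "\<And>n. extends (C n) (B n)" "C sums D" "B sums E"
  shows "extends D E"
  using assms(2,3) unfolding sums_def
  by (rule extends_limit[where C = "\<lambda>n. \<Sum>i<n. C i" and B = "\<lambda>n. \<Sum>i<n. B i", rotated])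
    (simp add: extends_sum assms(1))

lemma extends_op_exp: "extends C B \<Longrightarrow> extends (op_exp C) (op_exp B)"
  by (rule extends_sums[OF extends_scaleR[OF extends_power] op_exp_sums op_exp_sums])

lemma extends_op_log1p:
  assumes "extends C B" "norm C < 1" "norm B < 1"
  shows "extends (op_log1p C) (op_log1p B)"
  by (rule extends_sums[OF extends_scaleR[OF extends_power] op_log1p_sums op_log1p_sums, OF assms])

text \<open>
Formal adjointness with respect to the energy form becomes adjointness on the completion.
\<close>

lemma extends_adjoint:
  assumes "extends C B" "extends D E"
    and *: "\<And>f g. inner (J (blinfun_apply B f)) (J g) = inner (J f) (J (blinfun_apply E g))"
  shows "inner (blinfun_apply C x) y = inner x (blinfun_apply D y)"
proof (rule dense_induct[of "\<lambda>x. inner (blinfun_apply C x) y = inner x (blinfun_apply D y)"])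
  show "inner (blinfun_apply C (J f)) y = inner (J f) (blinfun_apply D y)" for f
    by (rule dense_induct[of "\<lambda>y. inner (blinfun_apply C (J f)) y = inner (J f) (blinfun_apply D y)"])
      (auto simp: extendsD[OF assms(1)] extendsD[OF assms(2)] * intro!: closed_Collect_eq continuous_intros)
qed (auto intro!: closed_Collect_eq continuous_intros)

text \<open>
Since \<open>adj\<close> is a definite description, this is where the existence of adjoints, and thus the Riesz
representation, is used.
\<close>

lemma symmetric_ops_iff:
  "B \<in> symmetric_ops A \<longleftrightarrow> B \<in> bounded_ops \<and>
    (\<forall>f g. inner (J (blinfun_apply B f)) (J g) = inner (J f) (J (blinfun_apply B g)))"
proof (cases "B \<in> bounded_ops")
  case True
  have *: "inner (blinfun_apply (adj B o\<^sub>L A) f) g = inner (J f) (J (blinfun_apply B g))"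
    "inner (blinfun_apply (A o\<^sub>L B) f) g = inner (J (blinfun_apply B f)) (J g)" for f g
    by (simp_all add: inner_adj_left[OF True] inner_J)
  have "adj B o\<^sub>L A = A o\<^sub>L B \<longleftrightarrow>
    (\<forall>f g. inner (blinfun_apply (adj B o\<^sub>L A) f) g = inner (blinfun_apply (A o\<^sub>L B) f) g)"
  proof
    assume "\<forall>f g. inner (blinfun_apply (adj B o\<^sub>L A) f) g = inner (blinfun_apply (A o\<^sub>L B) f) g"
    then show "adj B o\<^sub>L A = A o\<^sub>L B"
      by (intro blinfun_eqI) (metis vector_eq_rdot)
  qed simp
  then show ?thesis unfolding * using True by (auto simp: symmetric_ops_def)
qed (simp add: symmetric_ops_def)

lemma symmetric_ops_bounded: "B \<in> symmetric_ops A \<Longrightarrow> B \<in> bounded_ops"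
  and symmetric_ops_inner: "B \<in> symmetric_ops A \<Longrightarrow>
    inner (J (blinfun_apply B f)) (J g) = inner (J f) (J (blinfun_apply B g))"
  by (simp_all add: symmetric_ops_iff)

lemma subspace_symmetric_ops: "subspace (symmetric_ops A)"
  using bounded_linear.linear[OF J_bounded_linear] subspace_bounded_ops
  by (auto simp: subspace_def symmetric_ops_iff blinfun.bilinear_simps linear_0 linear_add linear_scale
      inner_add_left inner_add_right)

lemma closed_symmetric_ops: "closed (symmetric_ops A)"
proof -
  have "closed {B. inner (J (blinfun_apply B f)) (J g) = inner (J f) (J (blinfun_apply B g))}" for f g
    by (intro closed_Collect_eq continuous_intros bounded_linear.continuous_on[OF J_bounded_linear])
  then have "closed (bounded_ops \<inter> (\<Inter>f g. {B. inner (J (blinfun_apply B f)) (J g) = inner (J f) (J (blinfun_apply B g))}))"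
    using closed_bounded_ops by blast
  also have "\<dots> = symmetric_ops A" by (auto simp: symmetric_ops_iff)
  finally show ?thesis .
qed

text \<open>
The energy norms \<open>a n\<close> of the iterates \<open>B\<^sup>n f\<close> satisfy \<open>(a n)\<^sup>2 \<le> a 0 * a (2 n)\<close> by symmetry and
Cauchy-Schwarz. Hence they grow along the powers of 2 at least like \<open>(a 1 / a 0)\<^sup>n\<close>. But the energy
norm is dominated by the original norm, so that they cannot grow faster than \<open>\<parallel>B\<parallel>\<^sup>n\<close>.
\<close>

lemma norm_J_symmetric_le:
  assumes B: "B \<in> symmetric_ops A"
  shows "norm (J (blinfun_apply B f)) \<le> norm B * norm (J f)"
proof (rule ccontr)
  assume less: "\<not> ?thesis"
  obtain K where K: "K > 0" "\<And>f. norm (J f) \<le> norm f * K"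
    using bounded_linear.pos_bounded[OF J_bounded_linear] by blast
  define a where "a n = norm (J ((blinfun_apply B ^^ n) f))" for n
  have shift: "inner (J ((blinfun_apply B ^^ n) f)) (J ((blinfun_apply B ^^ m) f))
      = inner (J f) (J ((blinfun_apply B ^^ (n + m)) f))" for n m
  proof (induction n arbitrary: m)
    case (Suc n)
    show ?case using Suc[of "Suc m"] by (simp add: symmetric_ops_inner[OF B])
  qed simp
  have double: "(a n)\<^sup>2 \<le> a 0 * a (2 * n)" for n
  proof -
    have "(a n)\<^sup>2 = inner (J f) (J ((blinfun_apply B ^^ (n + n)) f))"
      unfolding a_def power2_norm_eq_inner by (rule shift)
    also have "\<dots> \<le> a 0 * a (2 * n)"
      unfolding a_def mult_2 by (simp add: norm_cauchy_schwarz)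
    finally show ?thesis .
  qed
  have a1: "a 1 > norm B * a 0" using less by (simp add: a_def)
  have "a 0 > 0"
  proof (rule ccontr)
    assume "\<not> a 0 > 0"
    then have "a 0 = 0" by (simp add: a_def)
    then have "a 1 = 0" using double[of 1] by simp
    then show False using a1 \<open>a 0 = 0\<close> by simp
  qed
  define q where "q = a 1 / a 0"
  have q: "q > norm B" using a1 \<open>a 0 > 0\<close> by (simp add: q_def field_simps)
  have lower: "a 0 * q ^ (2 ^ k) \<le> a (2 ^ k)" for k
  proof (induction k)
    case 0
    then show ?case using \<open>a 0 > 0\<close> by (simp add: q_def)
  next
    case (Suc k)
    have "0 \<le> a 0 * q ^ (2 ^ k)" using \<open>a 0 > 0\<close> q norm_ge_zero[of B] by (simp del: norm_ge_zero)
    then have "(a 0 * q ^ (2 ^ k))\<^sup>2 \<le> (a (2 ^ k))\<^sup>2" using Suc by (intro power_mono)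
    also have "\<dots> \<le> a 0 * a (2 ^ Suc k)" using double[of "2 ^ k"] by simp
    finally have "a 0 * (a 0 * q ^ (2 ^ Suc k)) \<le> a 0 * a (2 ^ Suc k)"
      by (simp add: power2_eq_square mult_ac mult_2 power_add)
    then show ?case using \<open>a 0 > 0\<close> by (simp add: mult_le_cancel_left_pos)
  qed
  have "norm ((blinfun_apply B ^^ n) f) \<le> norm B ^ n * norm f" for n
  proof (induction n)
    case (Suc n)
    have "norm ((blinfun_apply B ^^ Suc n) f) \<le> norm B * norm ((blinfun_apply B ^^ n) f)"
      by (simp add: norm_blinfun)
    also have "\<dots> \<le> norm B * (norm B ^ n * norm f)" using Suc by (rule mult_left_mono) simp
    finally show ?case by (simp add: mult_ac)
  qed simp
  then have upper: "a n \<le> norm B ^ n * norm f * K" for n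
    unfolding a_def using K by (meson order_trans mult_right_mono less_imp_le)
  have q0: "q > 0" using q norm_ge_zero[of B] by linarith
  have "(\<lambda>n. norm f * K * (norm B / q) ^ n) \<longlonglongrightarrow> norm f * K * 0"
    using q q0 by (intro tendsto_mult_left LIMSEQ_realpow_zero) auto
  then have "\<forall>\<^sub>F n in sequentially. norm f * K * (norm B / q) ^ n < a 0"
    using \<open>a 0 > 0\<close> by (simp add: order_tendstoD)
  then obtain N where N: "\<And>n. n \<ge> N \<Longrightarrow> norm f * K * (norm B / q) ^ n < a 0"
    by (auto simp: eventually_sequentially)
  have "N \<le> 2 ^ N" by (simp add: less_imp_le)
  from N[OF this] have "norm f * K * norm B ^ (2 ^ N) < a 0 * q ^ (2 ^ N)"
    using q0 by (simp add: power_divide field_simps)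
  with lower[of N] upper[of "2 ^ N"] show False by (simp add: mult_ac)
qed

text \<open>
By the preceding bound \<open>J f \<mapsto> J (B f)\<close> is well defined and Lipschitz on a dense subspace.
\<close>

lemma extends_exists:
  assumes B: "B \<in> symmetric_ops A"
  obtains C where "extends C B" "norm C \<le> norm B"
proof -
  interpret J: bounded_linear J by (rule J_bounded_linear)
  note le = norm_J_symmetric_le[OF B]
  have wd: "J (blinfun_apply B f) = J (blinfun_apply B g)" if "J f = J g" for f g
    using le[of "f - g"] that by (simp add: blinfun.bilinear_simps J.diff)
  define k where "k y = J (blinfun_apply B (inv J y))" for y
  have k: "k (J f) = J (blinfun_apply B f)" for f
    unfolding k_def by (rule wd) (simp add: f_inv_into_f)
  have lip: "norm (k x - k y) \<le> norm B * norm (x - y)" if "x \<in> range J" "y \<in> range J" for x y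
    using that le by (auto simp: k simp flip: J.diff blinfun.diff_right)
  have "uniformly_continuous_on (range J) k"
    unfolding uniformly_continuous_on_def
  proof (intro allI impI)
    fix e :: real assume "e > 0"
    have "dist (k x') (k x) < e" if "x \<in> range J" "x' \<in> range J" "dist x' x < e / (norm B + 1)" for x x'
    proof -
      have "norm B * norm (x' - x) \<le> (norm B + 1) * norm (x' - x)" by (simp add: distrib_right)
      also have "\<dots> < e" using that(3)
        by (simp add: dist_norm pos_less_divide_eq add_nonneg_pos mult.commute)
      finally show ?thesis using lip[OF that(2,1)] by (simp add: dist_norm)
    qed
    then show "\<exists>d>0. \<forall>x\<in>range J. \<forall>x'\<in>range J. dist x' x < d \<longrightarrow> dist (k x') (k x) < e"
      using \<open>e > 0\<close> by (intro exI[of _ "e / (norm B + 1)"]) (simp add: add_nonneg_pos)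
  qed
  then obtain C where C_cont: "continuous_on UNIV C" and C_k: "\<And>x. x \<in> range J \<Longrightarrow> k x = C x"
    using uniformly_continuous_on_extension_on_closure[of "range J" k] J_dense
      uniformly_continuous_imp_continuous by metis
  have C: "C (J f) = J (blinfun_apply B f)" for f using C_k[of "J f"] k by simp
  note cont = continuous_on_compose2[OF C_cont _ subset_UNIV]
  have C_add: "C (x + y) = C x + C y" for x y
  proof (rule dense_induct[of "\<lambda>x. C (x + y) = C x + C y"])
    show "C (J f + y) = C (J f) + C y" for f
      by (rule dense_induct[of "\<lambda>y. C (J f + y) = C (J f) + C y"])
        (auto simp: C blinfun.add_right J.add simp flip: J.add intro!: closed_Collect_eq continuous_intros cont)
  qed (auto intro!: closed_Collect_eq continuous_intros cont)
  have C_scaleC: "C (c *\<^sub>C x) = c *\<^sub>C C x" for c x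
    by (rule dense_induct[of "\<lambda>x. C (c *\<^sub>C x) = c *\<^sub>C C x"])
      (auto simp: C bounded_opsD[OF symmetric_ops_bounded[OF B]] J_scaleC simp flip: J_scaleC
        intro!: closed_Collect_eq continuous_intros cont
          bounded_linear.continuous_on[OF bounded_linear_scaleC_right])
  have C_norm: "norm (C x) \<le> norm B * norm x" for x
    by (rule dense_induct[of "\<lambda>x. norm (C x) \<le> norm B * norm x"])
      (auto simp: C le intro!: closed_Collect_le continuous_intros cont)
  have "bounded_linear C"
    by (rule bounded_linear_intro[of _ "norm B"])
      (simp_all add: C_add C_scaleC scaleR_scaleC, metis C_norm mult.commute)
  then have app: "blinfun_apply (Blinfun C) = C" by (rule bounded_linear_Blinfun_apply)
  show thesis
  proof
    show "extends (Blinfun C) B"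
      by (simp add: extends_def bounded_ops_def app C C_scaleC)
    show "norm (Blinfun C) \<le> norm B"
      by (rule norm_blinfun_bound) (simp_all add: app C_norm)
  qed
qed

lemma extends_extension: "B \<in> symmetric_ops A \<Longrightarrow> extends (extension J B) B"
  and norm_extension_le: "B \<in> symmetric_ops A \<Longrightarrow> norm (extension J B) \<le> norm B"
  by (metis extends_exists extension_eq)+

lemma extension_symmetric:
  assumes "B \<in> symmetric_ops A"
  shows "inner (blinfun_apply (extension J B) x) y = inner x (blinfun_apply (extension J B) y)"
  using extends_adjoint[OF extends_extension extends_extension, OF assms assms symmetric_ops_inner[OF assms]] .

end

section \<open>The geodesic between close idempotents\<close>

lemma op_alg_eqI: "of_alg x = of_alg y \<Longrightarrow> alg_scalar x = alg_scalar y \<Longrightarrow> x = y"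
  by (simp add: of_alg_def alg_scalar_def prod_eq_iff flip: op_alg_pair_inject)

lemma alg_scalar_simps [simp]:
  "alg_scalar 1 = 1" "alg_scalar (x * y) = alg_scalar x * alg_scalar y"
  "alg_scalar (x + y) = alg_scalar x + alg_scalar y" "alg_scalar (to_alg B) = 0"
  by (simp_all add: alg_scalar_def op_alg_rep_eqs to_alg_def Op_alg_inverse)

lemma op_exp_intertwine:
  fixes S B C :: "'a::complex_hilbert op"
  assumes "S o\<^sub>L B = C o\<^sub>L S"
  shows "S o\<^sub>L op_exp B = op_exp C o\<^sub>L S"
proof -
  have "to_alg S * to_alg B = to_alg C * to_alg S" by (rule op_alg_eqI) (simp_all add: assms)
  from arg_cong[OF exp_intertwine[OF this], of of_alg] show ?thesis by (simp add: of_alg_exp)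
qed

lemma op_log1p_intertwine:
  fixes S B C :: "'a::complex_hilbert op"
  assumes "S o\<^sub>L B = C o\<^sub>L S" "norm B < 1" "norm C < 1"
  shows "S o\<^sub>L op_log1p B = op_log1p C o\<^sub>L S"
proof -
  have "to_alg S * to_alg B = to_alg C * to_alg S" by (rule op_alg_eqI) (simp_all add: assms)
  from arg_cong[OF log1p_intertwine[OF this], of of_alg] assms show ?thesis by (simp add: of_alg_log1p)
qed

lemma op_exp_log1p: "norm B < 1 \<Longrightarrow> op_exp (op_log1p B) = id_blinfun + B"
  using arg_cong[OF exp_log1p[of "to_alg B"], of of_alg] by (simp add: of_alg_log1p of_alg_exp)

lemma op_log1p_inverse:
  assumes "norm B < 1" "norm C < 1"
    and "(id_blinfun + B) o\<^sub>L (id_blinfun + C) = id_blinfun"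
    and "(id_blinfun + C) o\<^sub>L (id_blinfun + B) = id_blinfun"
  shows "op_log1p C = - op_log1p B"
proof -
  have "(1 + to_alg B) * (1 + to_alg C) = 1" "(1 + to_alg C) * (1 + to_alg B) = 1"
    by (rule op_alg_eqI; simp add: assms)+
  from arg_cong[OF log1p_inverse[OF _ _ this], of of_alg] assms show ?thesis
    by (simp add: of_alg_log1p)
qed

lemma op_exp_0 [simp]: "op_exp 0 = id_blinfun"
  using of_alg_exp[of "0 :: 'a::complex_hilbert op_alg"] by (simp only: exp_zero of_alg_simps)

lemma op_exp_minus_inverse: "op_exp B o\<^sub>L op_exp (- B) = id_blinfun"
  using arg_cong[OF exp_minus_inverse[of "to_alg B"], of of_alg] by (simp add: of_alg_exp)

lemma op_exp_minus_inverse': "op_exp (- B) o\<^sub>L op_exp B = id_blinfun"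
  using op_exp_minus_inverse[of "- B"] by simp

lemma op_exp_double: "op_exp B o\<^sub>L op_exp B = op_exp (2 *\<^sub>R B)"
  using arg_cong[OF exp_add_commuting[of "to_alg B" "to_alg B"], of of_alg]
  by (simp add: of_alg_exp scaleR_2)

lemma op_exp_has_vector_derivative:
  assumes "t \<in> S"
  shows "((\<lambda>s. op_exp (s *\<^sub>R X)) has_vector_derivative op_exp (t *\<^sub>R X) o\<^sub>L X) (at t within S)"
proof -
  have "((\<lambda>s. s *\<^sub>R to_alg X) has_vector_derivative to_alg X) (at t within S)"
    by (auto intro!: derivative_eq_intros)
  from exp_commuting_has_vector_derivative[OF this assms]
  have "((\<lambda>s. exp (s *\<^sub>R to_alg X)) has_vector_derivative exp (t *\<^sub>R to_alg X) * to_alg X) (at t within S)"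
    by (simp add: mult.commute)
  from bounded_linear.has_vector_derivative[OF bounded_linear_of_alg this]
  show ?thesis by (simp add: of_alg_exp)
qed

lemma op_comp_assoc: "(B o\<^sub>L C) o\<^sub>L D = B o\<^sub>L (C o\<^sub>L D)"
  by (rule blinfun_eqI) simp

lemmas op_comp_linear =
  bounded_bilinear.add_left[OF bounded_bilinear_blinfun_compose]
  bounded_bilinear.add_right[OF bounded_bilinear_blinfun_compose]
  bounded_bilinear.diff_left[OF bounded_bilinear_blinfun_compose]
  bounded_bilinear.diff_right[OF bounded_bilinear_blinfun_compose]
  bounded_bilinear.minus_left[OF bounded_bilinear_blinfun_compose]
  bounded_bilinear.minus_right[OF bounded_bilinear_blinfun_compose]
  bounded_bilinear.scaleR_left[OF bounded_bilinear_blinfun_compose]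
  bounded_bilinear.scaleR_right[OF bounded_bilinear_blinfun_compose]

lemma op_comp_id [simp]: "B o\<^sub>L id_blinfun = B" "id_blinfun o\<^sub>L B = B"
  by (rule blinfun_eqI; simp)+

lemma op_exp_commute: "op_exp (t *\<^sub>R X) o\<^sub>L X = X o\<^sub>L op_exp (t *\<^sub>R X)"
  by (rule op_exp_intertwine[symmetric]) (simp add: op_comp_linear)

text \<open>
Orbit curves of one exponent are closed under differentiation, whence their smoothness.
\<close>

lemma orbit_curve_has_vector_derivative:
  assumes "t \<in> S"
  shows "(orbit_curve B X has_vector_derivative orbit_curve ((X o\<^sub>L B) - (B o\<^sub>L X)) X t) (at t within S)"
proof -
  let ?E = "\<lambda>t. op_exp (t *\<^sub>R X)" and ?E' = "\<lambda>t. op_exp (t *\<^sub>R (- X))"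
  note bilinear = bounded_bilinear.has_vector_derivative[OF bounded_bilinear_blinfun_compose]
  have orbit: "orbit_curve B X = (\<lambda>t. ?E t o\<^sub>L B o\<^sub>L ?E' t)" for B
    by (simp add: orbit_curve_def fun_eq_iff)
  have "(orbit_curve B X has_vector_derivative
      ((?E t o\<^sub>L B) o\<^sub>L (?E' t o\<^sub>L - X)) + (((?E t o\<^sub>L 0) + ((?E t o\<^sub>L X) o\<^sub>L B)) o\<^sub>L ?E' t)) (at t within S)"
    unfolding orbit
    by (intro bilinear op_exp_has_vector_derivative assms has_vector_derivative_const)
  also have "((?E t o\<^sub>L B) o\<^sub>L (?E' t o\<^sub>L - X)) + (((?E t o\<^sub>L 0) + ((?E t o\<^sub>L X) o\<^sub>L B)) o\<^sub>L ?E' t)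
      = orbit_curve ((X o\<^sub>L B) - (B o\<^sub>L X)) X t"
    unfolding orbit op_exp_commute[of t "- X"] by (simp add: op_comp_linear op_comp_assoc)
  finally show ?thesis .
qed

lemma smooth_orbit_curve: "smooth_on_interval a b (orbit_curve B X)"
  unfolding smooth_on_interval_def
  by (rule exI[of _ "\<lambda>k. orbit_curve (((\<lambda>B. (X o\<^sub>L B) - (B o\<^sub>L X)) ^^ k) B) X"])
    (auto intro: orbit_curve_has_vector_derivative)

lemma orbit_curve_0 [simp]: "orbit_curve B X 0 = B"
  by (simp add: orbit_curve_def)

lemma idempotent_apply: "Q o\<^sub>L Q = Q \<Longrightarrow> blinfun_apply Q (blinfun_apply Q f) = blinfun_apply Q f"
  by (metis blinfun_apply_blinfun_compose)

lemma eps_apply: "blinfun_apply (eps Q) f = 2 *\<^sub>R blinfun_apply Q f - f"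
  by (simp add: eps_def blinfun.bilinear_simps)

lemma eps_square: "Q o\<^sub>L Q = Q \<Longrightarrow> eps Q o\<^sub>L eps Q = id_blinfun"
  by (rule blinfun_eqI) (simp add: eps_apply blinfun.bilinear_simps idempotent_apply scaleR_2)

lemma orbit_curve_idempotent:
  fixes Q :: "'a::complex_hilbert op"
  assumes "Q o\<^sub>L Q = Q"
  shows "orbit_curve Q X t o\<^sub>L orbit_curve Q X t = orbit_curve Q X t"
proof -
  have "op_exp (- (t *\<^sub>R X)) o\<^sub>L (op_exp (t *\<^sub>R X) o\<^sub>L D) = D" for D :: "'a op"
    unfolding op_comp_assoc[symmetric] op_exp_minus_inverse' by simp
  moreover have "Q o\<^sub>L (Q o\<^sub>L D) = Q o\<^sub>L D" for D :: "'a op"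
    unfolding op_comp_assoc[symmetric] assms ..
  ultimately show ?thesis
    by (simp add: orbit_curve_def op_comp_assoc)
qed

lemma bounded_ops_power: "B \<in> bounded_ops \<Longrightarrow> op_power B n \<in> bounded_ops"
  by (induction n) (simp_all add: bounded_ops_compose)

lemma bounded_ops_sums:
  assumes "\<And>n. B n \<in> bounded_ops" "B sums C"
  shows "C \<in> bounded_ops"
  by (rule closed_sequentially[OF closed_bounded_ops _ assms(2)[unfolded sums_def]])
    (rule subspace_sum[OF subspace_bounded_ops], rule assms(1))

lemma bounded_ops_exp: "B \<in> bounded_ops \<Longrightarrow> op_exp B \<in> bounded_ops"
  by (rule bounded_ops_sums[OF _ op_exp_sums]) (rule bounded_ops_scaleR[OF bounded_ops_power])

lemma bounded_ops_log1p: "B \<in> bounded_ops \<Longrightarrow> norm B < 1 \<Longrightarrow> op_log1p B \<in> bounded_ops"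
  by (rule bounded_ops_sums[OF _ op_log1p_sums]) (rule bounded_ops_scaleR[OF bounded_ops_power])

lemma bounded_ops_eps: "Q \<in> bounded_ops \<Longrightarrow> eps Q \<in> bounded_ops"
  by (simp add: eps_def bounded_ops_diff bounded_ops_scaleR)

lemma bounded_ops_orbit_curve:
  "B \<in> bounded_ops \<Longrightarrow> X \<in> bounded_ops \<Longrightarrow> orbit_curve B X t \<in> bounded_ops"
  unfolding orbit_curve_def
  by (intro bounded_ops_compose bounded_ops_exp bounded_ops_minus bounded_ops_scaleR)

lemma geodesic_exponent_eq:
  "geodesic_exponent Q R = (1 / 2) *\<^sub>R op_log1p ((eps R o\<^sub>L eps Q) - id_blinfun)"
  by (simp add: geodesic_exponent_def op_log1p_def del: op_power_Suc)

text \<open>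
The hypothesis on \<open>\<parallel>Q - R\<parallel>\<close>, stated without a division, puts both \<open>eps R \<circ> eps Q\<close> and its inverse
\<open>eps Q \<circ> eps R\<close> into the domain of the logarithmic series. It holds on the original space as well as
for the extensions to the completion, so the locale serves both.
\<close>

locale close_idempotents =
  fixes Q R :: "'a::complex_hilbert op"
  assumes Q_idem: "Q o\<^sub>L Q = Q" and R_idem: "R o\<^sub>L R = R"
    and Q_bounded: "Q \<in> bounded_ops" and R_bounded: "R \<in> bounded_ops"
    and close: "2 * norm (eps Q) * norm (Q - R) < 1"
begin

lemma norm_eps_prod_less:
  "norm ((eps R o\<^sub>L eps Q) - id_blinfun) < 1" "norm ((eps Q o\<^sub>L eps R) - id_blinfun) < 1"
proof -
  have diff: "(eps R o\<^sub>L eps Q) - id_blinfun = (- 2) *\<^sub>R ((Q - R) o\<^sub>L eps Q)"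
    "(eps Q o\<^sub>L eps R) - id_blinfun = (- 2) *\<^sub>R (eps Q o\<^sub>L (Q - R))"
    unfolding eps_square[OF Q_idem, symmetric]
    by (simp_all add: op_comp_linear eps_def algebra_simps)
  have "norm ((- 2) *\<^sub>R ((Q - R) o\<^sub>L eps Q)) \<le> 2 * norm (eps Q) * norm (Q - R)"
    using norm_blinfun_compose[of "Q - R" "eps Q"] by (simp add: mult.commute)
  with close diff show "norm ((eps R o\<^sub>L eps Q) - id_blinfun) < 1" by simp
  have "norm ((- 2) *\<^sub>R (eps Q o\<^sub>L (Q - R))) \<le> 2 * norm (eps Q) * norm (Q - R)"
    using norm_blinfun_compose[of "eps Q" "Q - R"] by simp
  with close diff show "norm ((eps Q o\<^sub>L eps R) - id_blinfun) < 1" by simp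
qed

abbreviation X where "X \<equiv> geodesic_exponent Q R"

lemma exponent_reversed: "geodesic_exponent R Q = - X"
proof -
  have cancel: "eps Q o\<^sub>L (eps Q o\<^sub>L D) = D" "eps R o\<^sub>L (eps R o\<^sub>L D) = D" for D :: "'a op"
    unfolding op_comp_assoc[symmetric] eps_square[OF Q_idem] eps_square[OF R_idem] by simp_all
  have "op_log1p ((eps Q o\<^sub>L eps R) - id_blinfun) = - op_log1p ((eps R o\<^sub>L eps Q) - id_blinfun)"
    by (rule op_log1p_inverse[OF norm_eps_prod_less])
      (simp_all add: op_comp_assoc cancel eps_square Q_idem R_idem)
  then show ?thesis by (simp add: geodesic_exponent_eq)
qed

lemma exponent_bounded: "X \<in> bounded_ops"
  unfolding geodesic_exponent_eq
  by (intro bounded_ops_scaleR bounded_ops_log1p norm_eps_prod_less bounded_ops_diff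
      bounded_ops_compose bounded_ops_eps Q_bounded R_bounded bounded_ops_id)

text \<open>
Conjugation by \<open>eps Q\<close> exchanges \<open>eps R \<circ> eps Q\<close> and its inverse, so it changes the sign of the logarithm.
\<close>

lemma exponent_anticommutes: "eps Q o\<^sub>L X = - (X o\<^sub>L eps Q)"
proof -
  have "eps Q o\<^sub>L ((eps R o\<^sub>L eps Q) - id_blinfun) = ((eps Q o\<^sub>L eps R) - id_blinfun) o\<^sub>L eps Q"
    by (simp add: op_comp_linear op_comp_assoc)
  from op_log1p_intertwine[OF this norm_eps_prod_less]
  have "eps Q o\<^sub>L X = geodesic_exponent R Q o\<^sub>L eps Q"
    by (simp add: geodesic_exponent_eq op_comp_linear)
  then show ?thesis by (simp add: exponent_reversed op_comp_linear)
qed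

lemma exponent_split: "blinfun_apply Q (blinfun_apply X f) + blinfun_apply X (blinfun_apply Q f) = blinfun_apply X f"
proof -
  have "blinfun_apply (eps Q o\<^sub>L X) f = blinfun_apply (- (X o\<^sub>L eps Q)) f"
    by (simp only: exponent_anticommutes)
  then have "2 *\<^sub>R (blinfun_apply Q (blinfun_apply X f) + blinfun_apply X (blinfun_apply Q f))
      = 2 *\<^sub>R blinfun_apply X f"
    by (simp add: eps_apply blinfun.bilinear_simps scaleR_2 algebra_simps)
  then show ?thesis by simp
qed

lemma exponent_codiagonal:
  "Q o\<^sub>L X o\<^sub>L Q = 0" "(id_blinfun - Q) o\<^sub>L X o\<^sub>L (id_blinfun - Q) = 0"
proof -
  have *: "blinfun_apply Q (blinfun_apply X (blinfun_apply Q f)) = 0" for f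
    using exponent_split[of "blinfun_apply Q f"] arg_cong[OF exponent_split[of f], of "blinfun_apply Q"]
    by (simp add: blinfun.bilinear_simps idempotent_apply[OF Q_idem])
  then show "Q o\<^sub>L X o\<^sub>L Q = 0" by (intro blinfun_eqI) simp
  show "(id_blinfun - Q) o\<^sub>L X o\<^sub>L (id_blinfun - Q) = 0"
  proof (rule blinfun_eqI)
    fix f
    have "blinfun_apply X f - blinfun_apply Q (blinfun_apply X f) = blinfun_apply X (blinfun_apply Q f)"
      by (subst exponent_split[of f, symmetric]) simp
    then show "blinfun_apply ((id_blinfun - Q) o\<^sub>L X o\<^sub>L (id_blinfun - Q)) f = blinfun_apply 0 f"
      by (simp add: blinfun.bilinear_simps *)
  qed
qed

text \<open>
Up to the reflection \<open>eps Q\<close> the initial velocity of the geodesic is its exponent.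
\<close>

lemma commutator_eq: "(X o\<^sub>L Q) - (Q o\<^sub>L X) = X o\<^sub>L eps Q"
proof (rule blinfun_eqI)
  fix f
  have "blinfun_apply X (blinfun_apply Q f) - blinfun_apply Q (blinfun_apply X f)
      = 2 *\<^sub>R blinfun_apply X (blinfun_apply Q f) - blinfun_apply X f"
    by (subst exponent_split[of f, symmetric]) (simp add: scaleR_2)
  then show "blinfun_apply ((X o\<^sub>L Q) - (Q o\<^sub>L X)) f = blinfun_apply (X o\<^sub>L eps Q) f"
    by (simp add: eps_apply blinfun.bilinear_simps)
qed

lemma exp_exponent_double: "op_exp (2 *\<^sub>R X) = eps R o\<^sub>L eps Q"
  using op_exp_log1p[OF norm_eps_prod_less(1)] by (simp add: geodesic_exponent_eq)

text \<open>
As \<open>X\<close> anticommutes with \<open>eps Q\<close>, the right factor \<open>exp (- X)\<close> moves across \<open>eps Q\<close> and becomes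
\<open>exp X\<close>. Hence the reflection at time 1 is \<open>exp (2 X) \<circ> eps Q = eps R \<circ> eps Q \<circ> eps Q = eps R\<close>.
\<close>

lemma orbit_curve_1: "orbit_curve Q X 1 = R"
proof -
  have "eps Q o\<^sub>L op_exp (- X) = op_exp X o\<^sub>L eps Q"
    by (rule op_exp_intertwine) (simp add: op_comp_linear exponent_anticommutes)
  then have "op_exp X o\<^sub>L eps Q o\<^sub>L op_exp (- X) = op_exp X o\<^sub>L op_exp X o\<^sub>L eps Q"
    by (simp add: op_comp_assoc)
  also have "\<dots> = eps R"
    by (simp add: op_exp_double exp_exponent_double op_comp_assoc eps_square Q_idem)
  finally have "2 *\<^sub>R orbit_curve Q X 1 - id_blinfun = 2 *\<^sub>R R - id_blinfun"
    by (simp add: orbit_curve_def eps_def op_comp_linear op_exp_minus_inverse)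
  then show ?thesis by simp
qed

lemma idempotent_geodesic_orbit_curve: "idempotent_geodesic Q (orbit_curve Q X)"
  unfolding idempotent_geodesic_def idempotents_def
  using Q_idem Q_bounded exponent_bounded exponent_codiagonal by blast

end

section \<open>Piecewise smooth curves and arcs on the unit sphere\<close>

lemma vector_derivative_in_closed_subspace:
  fixes \<gamma> :: "real \<Rightarrow> 'v::real_normed_vector"
  assumes T: "subspace T" "closed T" and "a < b" "t \<in> {a..b}"
    and in_T: "\<And>s. s \<in> {a..b} \<Longrightarrow> \<gamma> s \<in> T"
    and der: "(\<gamma> has_vector_derivative d) (at t within {a..b})"
  shows "d \<in> T"
proof (rule Lim_in_closed_set[OF T(2)])
  show "\<forall>\<^sub>F s in at t within {a..b}. (\<gamma> s - \<gamma> t) /\<^sub>R (s - t) \<in> T"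
    using in_T \<open>t \<in> {a..b}\<close> T(1)
    by (auto simp: eventually_at_filter intro!: always_eventually subspace_scale subspace_diff)
  show "at t within {a..b} \<noteq> bot"
    using \<open>a < b\<close> \<open>t \<in> {a..b}\<close> by (simp add: trivial_limit_within islimpt_Icc)
  have "((\<lambda>s. norm (\<gamma> s - \<gamma> t - (s - t) *\<^sub>R d) / norm (s - t)) \<longlongrightarrow> 0) (at t within {a..b})"
    using der by (simp add: has_vector_derivative_def has_derivative_iff_norm)
  moreover have "\<forall>\<^sub>F s in at t within {a..b}.
      norm (\<gamma> s - \<gamma> t - (s - t) *\<^sub>R d) / norm (s - t) = norm ((\<gamma> s - \<gamma> t) /\<^sub>R (s - t) - d)"
  proof (unfold eventually_at_filter, intro always_eventually allI impI)
    fix s assume "s \<noteq> t" "s \<in> {a..b}"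
    then have "(\<gamma> s - \<gamma> t) /\<^sub>R (s - t) - d = (\<gamma> s - \<gamma> t - (s - t) *\<^sub>R d) /\<^sub>R (s - t)"
      by (simp add: scaleR_right_diff_distrib)
    then show "norm (\<gamma> s - \<gamma> t - (s - t) *\<^sub>R d) / norm (s - t) = norm ((\<gamma> s - \<gamma> t) /\<^sub>R (s - t) - d)"
      by (simp add: divide_inverse mult.commute)
  qed
  ultimately have "((\<lambda>s. norm ((\<gamma> s - \<gamma> t) /\<^sub>R (s - t) - d)) \<longlongrightarrow> 0) (at t within {a..b})"
    by (rule Lim_transform_eventually)
  then show "((\<lambda>s. (\<gamma> s - \<gamma> t) /\<^sub>R (s - t)) \<longlongrightarrow> d) (at t within {a..b})"
    by (simp add: tendsto_norm_zero_iff LIM_zero_iff)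
qed

lemma smooth_on_intervalE:
  assumes "smooth_on_interval a b \<gamma>"
  obtains D where "continuous_on {a..b} D"
    and "\<And>t. t \<in> {a..b} \<Longrightarrow> (\<gamma> has_vector_derivative D t) (at t within {a..b})"
proof -
  obtain D where D0: "\<And>t. t \<in> {a..b} \<Longrightarrow> D 0 t = \<gamma> t"
    and D: "\<And>k t. t \<in> {a..b} \<Longrightarrow> (D k has_vector_derivative D (Suc k) t) (at t within {a..b})"
    using assms unfolding smooth_on_interval_def by blast
  show thesis
  proof
    show "continuous_on {a..b} (D (Suc 0))"
      by (rule continuous_on_vector_derivative[OF D])
    show "(\<gamma> has_vector_derivative D (Suc 0) t) (at t within {a..b})" if "t \<in> {a..b}" for t
      using that D0 by (intro has_vector_derivative_transform[OF that _ D[OF that]]) simp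
  qed
qed

lemma piecewise_smooth_continuous_derivative:
  fixes \<gamma> :: "real \<Rightarrow> 'v::real_normed_vector"
  assumes "piecewise_smooth \<gamma>"
  obtains S where "finite S" "continuous_on {0..1} \<gamma>"
    "\<And>t. t \<in> {0<..<1} - S \<Longrightarrow> (\<gamma> has_vector_derivative vector_derivative \<gamma> (at t)) (at t)"
proof -
  obtain n s where s: "s 0 = 0" "s n = 1" "\<And>i. i < n \<Longrightarrow> s i < s (Suc i)"
    "\<And>i. i < n \<Longrightarrow> smooth_on_interval (s i) (s (Suc i)) \<gamma>"
    using assms unfolding piecewise_smooth_def by blast
  have "s 0 \<le> s k \<and> continuous_on {s 0..s k} \<gamma> \<and>
    (\<forall>t\<in>{s 0<..<s k} - s ` {..k}. (\<gamma> has_vector_derivative vector_derivative \<gamma> (at t)) (at t))"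
    if "k \<le> n" for k
    using that
  proof (induction k)
    case (Suc k)
    then have IH: "s 0 \<le> s k" "continuous_on {s 0..s k} \<gamma>"
      "\<And>t. t \<in> {s 0<..<s k} - s ` {..k} \<Longrightarrow> (\<gamma> has_vector_derivative vector_derivative \<gamma> (at t)) (at t)"
      and less: "s k < s (Suc k)" using s(3) by auto
    obtain D where D: "\<And>t. t \<in> {s k..s (Suc k)} \<Longrightarrow>
        (\<gamma> has_vector_derivative D t) (at t within {s k..s (Suc k)})"
      using s(4)[of k] Suc.prems smooth_on_intervalE by (metis Suc_le_lessD)
    have "{s 0..s (Suc k)} = {s 0..s k} \<union> {s k..s (Suc k)}" using IH(1) less by auto
    moreover have "continuous_on {s k..s (Suc k)} \<gamma>"
      by (rule continuous_on_vector_derivative[OF D])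
    ultimately have "continuous_on {s 0..s (Suc k)} \<gamma>"
      using IH(2) by (simp add: continuous_on_closed_Un)
    moreover have "(\<gamma> has_vector_derivative vector_derivative \<gamma> (at t)) (at t)"
      if t: "t \<in> {s 0<..<s (Suc k)} - s ` {..Suc k}" for t
    proof (cases "t < s k")
      case True
      then show ?thesis using t by (intro IH(3)) auto
    next
      case False
      moreover have "t \<noteq> s k" using t by auto
      ultimately have "s k < t" "t < s (Suc k)" using t by auto
      then have "(\<gamma> has_vector_derivative D t) (at t)"
        using D[of t] by (simp add: at_within_Icc_at)
      then show ?thesis by (simp add: vector_derivative_at)
    qed
    ultimately show ?case using IH(1) less by auto
  qed simp
  from this[of n] s show thesis by (intro that[of "s ` {..n}"]) auto
qed

text \<open>
On each piece the velocity agrees, up to the break points, with a continuous function into the closed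
subspace \<open>T\<close>. The lemma is meant for the Finsler norm \<open>F\<close> and the space \<open>T\<close> of symmetric operators,
on which it is continuous.
\<close>

lemma piecewise_smooth_speed_integrable:
  fixes \<gamma> :: "real \<Rightarrow> 'v::real_normed_vector" and F :: "'v \<Rightarrow> real"
  assumes "piecewise_smooth \<gamma>" and T: "subspace T" "closed T"
    and in_T: "\<And>t. t \<in> {0..1} \<Longrightarrow> \<gamma> t \<in> T" and F: "continuous_on T F"
  shows "(\<lambda>t. F (vector_derivative \<gamma> (at t within {0..1}))) integrable_on {0..1}"
proof -
  obtain n s where s: "s 0 = 0" "s n = 1" "\<And>i. i < n \<Longrightarrow> s i < s (Suc i)"
    "\<And>i. i < n \<Longrightarrow> smooth_on_interval (s i) (s (Suc i)) \<gamma>"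
    using assms unfolding piecewise_smooth_def by blast
  have le: "s i \<le> s j" if "i \<le> j" "j \<le> n" for i j
    using that
  proof (induction j rule: dec_induct)
    case (step m)
    then show ?case using s(3)[of m] by simp
  qed simp
  have "(\<lambda>t. F (vector_derivative \<gamma> (at t within {0..1}))) integrable_on {s 0..s k}" if "k \<le> n" for k
    using that
  proof (induction k)
    case (Suc k)
    have less: "s k < s (Suc k)" using Suc.prems s(3) by simp
    have bounds: "0 \<le> s k" "s (Suc k) \<le> 1"
      using le[of 0 k] le[of "Suc k" n] s(1,2) Suc.prems by auto
    then have sub: "{s k..s (Suc k)} \<subseteq> {0..1}" by auto
    obtain D where cont: "continuous_on {s k..s (Suc k)} D" and D: "\<And>t. t \<in> {s k..s (Suc k)} \<Longrightarrow>
        (\<gamma> has_vector_derivative D t) (at t within {s k..s (Suc k)})"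
      using s(4)[of k] Suc.prems smooth_on_intervalE by (metis Suc_le_lessD)
    have "D t \<in> T" if "t \<in> {s k..s (Suc k)}" for t
      using vector_derivative_in_closed_subspace[OF T less that _ D[OF that]] in_T sub by blast
    then have "continuous_on {s k..s (Suc k)} (\<lambda>t. F (D t))"
      by (intro continuous_on_compose2[OF F cont]) auto
    then have int: "(\<lambda>t. F (D t)) integrable_on {s k..s (Suc k)}"
      by (rule integrable_continuous_real)
    have "(\<lambda>t. F (vector_derivative \<gamma> (at t within {0..1}))) integrable_on {s k..s (Suc k)}"
    proof (rule integrable_spike_finite[OF _ _ int])
      show "finite {s k, s (Suc k)}" by simp
      fix t assume t: "t \<in> {s k..s (Suc k)} - {s k, s (Suc k)}"
      then have "(\<gamma> has_vector_derivative D t) (at t)"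
        using D[of t] by (simp add: at_within_Icc_at)
      moreover have "0 < t" "t < 1" using t bounds by auto
      ultimately show "F (vector_derivative \<gamma> (at t within {0..1})) = F (D t)"
        by (simp add: at_within_Icc_at vector_derivative_at)
    qed
    moreover have "s 0 \<le> s k" using bounds s(1) by simp
    ultimately show ?case
      using Henstock_Kurzweil_Integration.integrable_combine[OF _ less_imp_le[OF less]] Suc.IH Suc.prems by simp
  qed (metis box_real(2) integrable_on_refl)
  from this[of n] s show ?thesis by simp
qed

text \<open>
With \<open>h t = \<langle>u t, u 0\<rangle>\<close> the tangency of \<open>u'\<close> gives \<open>\<bar>h'\<bar> \<le> v sqrt (1 - h\<^sup>2)\<close>, that is, the angle
\<open>arccos h\<close> changes with speed at most \<open>v\<close>. As \<open>arccos\<close> is not differentiable at \<open>1 = h 0\<close> and at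
\<open>- 1\<close>, the estimate is made for \<open>arccos (r h)\<close> with \<open>r < 1\<close>, whose speed obeys the same bound, and
then \<open>r\<close> tends to 1.
\<close>

lemma sphere_distance_le_length:
  fixes u :: "real \<Rightarrow> 'b::real_inner"
  assumes S: "finite S" and cont: "continuous_on {0..1} u"
    and sphere: "\<And>t. t \<in> {0..1} \<Longrightarrow> norm (u t) = 1"
    and der: "\<And>t. t \<in> {0<..<1} - S \<Longrightarrow> (u has_vector_derivative u' t) (at t)"
    and speed: "\<And>t. t \<in> {0<..<1} - S \<Longrightarrow> norm (u' t) \<le> v t"
    and int: "v integrable_on {0..1}"
  shows "arccos (inner (u 1) (u 0)) \<le> integral {0..1} v"
proof -
  define h where "h t = inner (u t) (u 0)" for t
  have h_bound: "\<bar>h t\<bar> \<le> 1" if "t \<in> {0..1}" for t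
    using Cauchy_Schwarz_ineq2[of "u t" "u 0"] sphere[OF that] sphere[of 0] by (simp add: h_def)
  have tangent: "inner (u t) (u' t) = 0" if t: "t \<in> {0<..<1} - S" for t
  proof -
    have "((\<lambda>s. inner (u s) (u s)) has_real_derivative 2 * inner (u t) (u' t)) (at t)"
      using der[OF t]
      by (auto simp: has_vector_derivative_def has_field_derivative_def inner_commute
          intro!: derivative_eq_intros)
    moreover have "((\<lambda>s. inner (u s) (u s)) has_real_derivative 0) (at t)"
    proof (rule has_field_derivative_transform_within_open)
      show "((\<lambda>s::real. 1) has_real_derivative 0) (at t)" by simp
      show "1 = inner (u s) (u s)" if "s \<in> {0<..<1}" for s
        using sphere[of s] that by (simp add: dot_square_norm)
    qed (use t in auto)
    ultimately show ?thesis using DERIV_unique by fastforce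
  qed
  have h_der: "(h has_real_derivative inner (u' t) (u 0)) (at t)" if "t \<in> {0<..<1} - S" for t
    unfolding h_def using der[OF that]
    by (auto simp: has_vector_derivative_def has_field_derivative_def mult.commute
        intro!: derivative_eq_intros)
  have h'_bound: "\<bar>inner (u' t) (u 0)\<bar> \<le> v t * sqrt (1 - (h t)\<^sup>2)" if t: "t \<in> {0<..<1} - S" for t
  proof -
    have "(norm (u 0 - h t *\<^sub>R u t))\<^sup>2 = 1 - (h t)\<^sup>2"
    proof -
      have "inner (u t) (u t) = 1" "inner (u 0) (u 0) = 1"
        using sphere[of t] sphere[of 0] t by (simp_all add: dot_square_norm)
      then show ?thesis
        unfolding power2_norm_eq_inner
        by (simp add: inner_diff_left inner_diff_right h_def inner_commute power2_eq_square)
    qed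
    then have norm_eq: "norm (u 0 - h t *\<^sub>R u t) = sqrt (1 - (h t)\<^sup>2)"
      by (metis norm_ge_zero real_sqrt_unique)
    have "inner (u' t) (u 0) = inner (u' t) (u 0 - h t *\<^sub>R u t)"
      using tangent[OF t] by (simp add: inner_diff_right inner_commute)
    also have "\<bar>\<dots>\<bar> \<le> norm (u' t) * norm (u 0 - h t *\<^sub>R u t)" by (rule Cauchy_Schwarz_ineq2)
    also have "\<dots> \<le> v t * sqrt (1 - (h t)\<^sup>2)"
      unfolding norm_eq by (intro mult_right_mono speed[OF t]) (use h_bound[of t] t in \<open>simp add: abs_square_le_1\<close>)
    finally show ?thesis .
  qed
  have shrunk: "arccos (r * h 1) \<le> arccos r + integral {0..1} v" if r: "0 \<le> r" "r < 1" for r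
  proof -
    \<comment> \<open>The derivative of \<open>arccos (r h)\<close>; where the path need not be differentiable the value \<open>v t\<close>
      keeps the inequality \<open>g' \<le> v\<close> true everywhere.\<close>
    define g' where "g' t = (if t \<in> {0<..<1} - S
      then - (r * inner (u' t) (u 0)) / sqrt (1 - (r * h t)\<^sup>2) else v t)" for t
    have rh: "\<bar>r * h t\<bar> < 1" if "t \<in> {0..1}" for t
    proof -
      have "\<bar>r * h t\<bar> \<le> r * 1"
        using h_bound[OF that] r by (simp add: abs_mult mult_left_mono del: mult_1_right)
      then show ?thesis using r by simp
    qed
    have "(g' has_integral arccos (r * h 1) - arccos (r * h 0)) {0..1}"
    proof (rule fundamental_theorem_of_calculus_interior_strong[OF S])
      fix t assume t: "t \<in> {0<..<1} - S"
      then have "((\<lambda>t. arccos (r * h t)) has_real_derivative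
          inverse (- sqrt (1 - (r * h t)\<^sup>2)) * (r * inner (u' t) (u 0))) (at t)"
        using rh[of t]
        by (intro DERIV_chain2[OF DERIV_arccos] DERIV_cmult h_der) (auto simp: abs_less_iff)
      then show "((\<lambda>t. arccos (r * h t)) has_vector_derivative g' t) (at t)"
        using t by (simp add: g'_def has_real_derivative_iff_has_vector_derivative divide_inverse mult.commute)
    next
      show "continuous_on {0..1} (\<lambda>t. arccos (r * h t))"
      proof (rule continuous_on_arccos)
        show "continuous_on {0..1} (\<lambda>t. r * h t)"
          unfolding h_def by (intro continuous_intros cont)
        show "\<forall>t\<in>{0..1}. - 1 \<le> r * h t \<and> r * h t \<le> 1"
          using rh by (auto simp: abs_less_iff less_imp_le)
      qed
    qed simp
    moreover have "g' t \<le> v t" if "t \<in> {0..1}" for t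
    proof (cases "t \<in> {0<..<1} - S")
      case True
      have v: "0 \<le> v t" using speed[OF True] norm_ge_zero[of "u' t"] by linarith
      have pos: "0 < sqrt (1 - (r * h t)\<^sup>2)" using rh[OF that] by (simp add: abs_square_less_1)
      have shrink: "(r * h t)\<^sup>2 \<le> (h t)\<^sup>2"
        using r by (simp add: power_mult_distrib mult_left_le_one_le power_le_one)
      have "r * \<bar>inner (u' t) (u 0)\<bar> \<le> 1 * (v t * sqrt (1 - (r * h t)\<^sup>2))"
      proof (intro mult_mono)
        have "v t * sqrt (1 - (h t)\<^sup>2) \<le> v t * sqrt (1 - (r * h t)\<^sup>2)"
          using v shrink by (intro mult_left_mono) auto
        with h'_bound[OF True]
        show "\<bar>inner (u' t) (u 0)\<bar> \<le> v t * sqrt (1 - (r * h t)\<^sup>2)" by linarith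
      qed (use r in auto)
      moreover have "- (r * inner (u' t) (u 0)) \<le> r * \<bar>inner (u' t) (u 0)\<bar>"
        using r by (metis abs_ge_minus_self abs_mult abs_of_nonneg)
      ultimately have "- (r * inner (u' t) (u 0)) \<le> v t * sqrt (1 - (r * h t)\<^sup>2)" by linarith
      then have "- (r * inner (u' t) (u 0)) / sqrt (1 - (r * h t)\<^sup>2) \<le> v t"
        by (simp only: pos_divide_le_eq[OF pos])
      then show ?thesis
        using True by (simp only: g'_def if_True)
    qed (auto simp: g'_def)
    ultimately have "arccos (r * h 1) - arccos (r * h 0) \<le> integral {0..1} v"
      using int by (intro has_integral_le[OF _ integrable_integral[OF int]]) auto
    moreover have "h 0 = 1" using sphere[of 0] by (simp add: h_def dot_square_norm)
    ultimately show ?thesis by simp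
  qed
  have "(\<lambda>n. real n / real (Suc n)) \<longlonglongrightarrow> 1" by (rule LIMSEQ_n_over_Suc_n)
  then have lim: "(\<lambda>n. arccos (real n / real (Suc n) * c)) \<longlonglongrightarrow> arccos (1 * c)" if "\<bar>c\<bar> \<le> 1" for c
  proof (intro continuous_on_tendsto_compose[OF continuous_on_arccos'] tendsto_mult tendsto_const)
    have "\<bar>real n / real (Suc n) * c\<bar> \<le> 1" for n
      using mult_mono[of "real n / real (Suc n)" 1 "\<bar>c\<bar>" 1] that by (simp add: abs_mult)
    then have "real n / real (Suc n) * c \<in> {- 1..1}" for n
      unfolding abs_le_iff atLeastAtMost_iff by (simp only: minus_le_iff[of _ 1])
    then show "\<forall>\<^sub>F n in sequentially. real n / real (Suc n) * c \<in> {- 1..1}"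
      by (intro always_eventually allI)
    show "1 * c \<in> {- 1..1}" using that by (auto simp: abs_le_iff)
  qed
  have "arccos (1 * h 1) \<le> arccos (1 * 1) + integral {0..1} v"
  proof (rule LIMSEQ_le)
    show "(\<lambda>n. arccos (real n / real (Suc n) * h 1)) \<longlonglongrightarrow> arccos (1 * h 1)"
      by (rule lim) (simp add: h_bound)
    show "(\<lambda>n. arccos (real n / real (Suc n) * 1) + integral {0..1} v) \<longlonglongrightarrow> arccos (1 * 1) + integral {0..1} v"
      by (intro tendsto_add tendsto_const lim) simp
    have "arccos (real n / real (Suc n) * h 1) \<le> arccos (real n / real (Suc n) * 1) + integral {0..1} v" for n
      using shrunk[of "real n / real (Suc n)"] by simp
    then show "\<exists>N. \<forall>n\<ge>N. arccos (real n / real (Suc n) * h 1) \<le> arccos (real n / real (Suc n) * 1) + integral {0..1} v"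
      by blast
  qed
  then show ?thesis by (simp add: h_def)
qed

section \<open>Approximate eigenvectors\<close>

text \<open>
The sequence of vectors is a parameter: with it fixed, the pairs of an operator and its
approximate eigenvalue are closed under sums, products and limits, hence under power series.
\<close>

definition approx_eigenvalue :: "(nat \<Rightarrow> 'b::complex_hilbert) \<Rightarrow> 'b op \<Rightarrow> complex \<Rightarrow> bool"
  where "approx_eigenvalue \<psi> S s \<longleftrightarrow> (\<lambda>n. blinfun_apply S (\<psi> n) - s *\<^sub>C \<psi> n) \<longlonglongrightarrow> 0"

lemma approx_eigenvalue_id: "approx_eigenvalue \<psi> id_blinfun 1"
  by (simp add: approx_eigenvalue_def)

lemma approx_eigenvalue_add:
  "approx_eigenvalue \<psi> S s \<Longrightarrow> approx_eigenvalue \<psi> T t \<Longrightarrow> approx_eigenvalue \<psi> (S + T) (s + t)"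
  unfolding approx_eigenvalue_def
  by (drule (1) tendsto_add) (simp add: blinfun.add_left scaleC_add_left algebra_simps)

lemma approx_eigenvalue_scaleR:
  "approx_eigenvalue \<psi> S s \<Longrightarrow> approx_eigenvalue \<psi> (r *\<^sub>R S) (r *\<^sub>R s)"
  unfolding approx_eigenvalue_def
  by (drule tendsto_scaleR[OF tendsto_const[of r]])
    (simp add: blinfun.scaleR_left scaleR_diff_right scaleR_scaleC[of r "s *\<^sub>C _"] scaleC_scaleC
      scaleR_conv_of_real)

lemma approx_eigenvalue_compose:
  assumes S: "approx_eigenvalue \<psi> S s" and T: "approx_eigenvalue \<psi> T t" and "S \<in> bounded_ops"
  shows "approx_eigenvalue \<psi> (S o\<^sub>L T) (s * t)"
proof -
  have "(\<lambda>n. blinfun_apply S (blinfun_apply T (\<psi> n) - t *\<^sub>C \<psi> n)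
      + t *\<^sub>C (blinfun_apply S (\<psi> n) - s *\<^sub>C \<psi> n)) \<longlonglongrightarrow> blinfun_apply S 0 + t *\<^sub>C 0"
    using S T unfolding approx_eigenvalue_def
    by (intro tendsto_add blinfun.tendsto tendsto_const
        bounded_linear.tendsto[OF bounded_linear_scaleC_right])
  then show ?thesis
    by (simp add: approx_eigenvalue_def blinfun.diff_right bounded_opsD[OF \<open>S \<in> bounded_ops\<close>]
        scaleC_diff_right scaleC_scaleC mult.commute)
qed

lemma approx_eigenvalue_power:
  assumes "approx_eigenvalue \<psi> S s" "S \<in> bounded_ops"
  shows "approx_eigenvalue \<psi> (op_power S n) (s ^ n)"
  by (induction n) (simp_all add: assms approx_eigenvalue_id approx_eigenvalue_compose)

lemma approx_eigenvalue_sum: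
  fixes n :: nat
  shows "(\<And>i. i < n \<Longrightarrow> approx_eigenvalue \<psi> (S i) (s i)) \<Longrightarrow> approx_eigenvalue \<psi> (\<Sum>i<n. S i) (\<Sum>i<n. s i)"
proof (induction n)
  case 0
  show ?case using approx_eigenvalue_scaleR[OF approx_eigenvalue_id, of \<psi> 0] by simp
next
  case (Suc n)
  then show ?case by (simp add: approx_eigenvalue_add)
qed

context
  fixes \<psi> :: "nat \<Rightarrow> 'b::complex_hilbert"
  assumes unit: "\<And>n. norm (\<psi> n) = 1"
begin

lemma approx_eigenvalue_limit:
  assumes ae: "\<And>k. approx_eigenvalue \<psi> (S k) (s k)" and S: "S \<longlonglongrightarrow> T" and s: "s \<longlonglongrightarrow> t"
  shows "approx_eigenvalue \<psi> T t"
  unfolding approx_eigenvalue_def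
proof (rule LIMSEQ_I)
  fix e :: real assume "e > 0"
  then have e: "e / 3 > 0" by simp
  obtain k where k: "norm (S k - T) < e / 3" "norm (s k - t) < e / 3"
    using LIMSEQ_D[OF S e] LIMSEQ_D[OF s e] by (meson nle_le)
  obtain N where N: "\<And>n. n \<ge> N \<Longrightarrow> norm (blinfun_apply (S k) (\<psi> n) - s k *\<^sub>C \<psi> n) < e / 3"
    using LIMSEQ_D[OF ae[of k, unfolded approx_eigenvalue_def] e] by auto
  have "norm (blinfun_apply T (\<psi> n) - t *\<^sub>C \<psi> n - 0) < e" if "n \<ge> N" for n
  proof -
    have "blinfun_apply T (\<psi> n) - t *\<^sub>C \<psi> n - 0 = (blinfun_apply (S k) (\<psi> n) - s k *\<^sub>C \<psi> n)
        - blinfun_apply (S k - T) (\<psi> n) + (s k - t) *\<^sub>C \<psi> n"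
      by (simp add: blinfun.diff_left scaleC_diff_left)
    also have "norm \<dots> \<le> norm (blinfun_apply (S k) (\<psi> n) - s k *\<^sub>C \<psi> n)
        + norm (blinfun_apply (S k - T) (\<psi> n)) + norm ((s k - t) *\<^sub>C \<psi> n)"
      by (intro norm_triangle_mono norm_triangle_ineq4 order_refl)
    also have "\<dots> < e / 3 + e / 3 + e / 3"
      using N[OF that] norm_blinfun[of "S k - T" "\<psi> n"] k by (intro add_strict_mono) (auto simp: norm_scaleC unit)
    finally show ?thesis by simp
  qed
  then show "\<exists>N. \<forall>n\<ge>N. norm (blinfun_apply T (\<psi> n) - t *\<^sub>C \<psi> n - 0) < e" by blast
qed

lemma approx_eigenvalue_sums:
  assumes "\<And>k. approx_eigenvalue \<psi> (S k) (s k)" "S sums T" "s sums t"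
  shows "approx_eigenvalue \<psi> T t"
  using assms(2,3) unfolding sums_def
  by (rule approx_eigenvalue_limit[where S = "\<lambda>n. \<Sum>i<n. S i" and s = "\<lambda>n. \<Sum>i<n. s i", rotated])
    (rule approx_eigenvalue_sum, rule assms(1))

lemma approx_eigenvalue_exp:
  assumes "approx_eigenvalue \<psi> S s" "S \<in> bounded_ops"
  shows "approx_eigenvalue \<psi> (op_exp S) (exp s)"
proof (rule approx_eigenvalue_sums[OF _ op_exp_sums])
  show "approx_eigenvalue \<psi> ((1 / fact k) *\<^sub>R op_power S k) ((1 / fact k) *\<^sub>R s ^ k)" for k
    by (intro approx_eigenvalue_scaleR approx_eigenvalue_power assms)
  show "(\<lambda>k. (1 / fact k) *\<^sub>R s ^ k) sums exp s"
    using exp_converges[of s] by (simp add: divide_inverse)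
qed

lemma approx_eigenvalue_norm_le:
  assumes "approx_eigenvalue \<psi> S s"
  shows "cmod s \<le> norm S"
proof -
  have "cmod s \<le> norm S + norm (0 :: 'b)"
  proof (rule LIMSEQ_le)
  show "(\<lambda>n. cmod s) \<longlonglongrightarrow> cmod s" by simp
  show "(\<lambda>n. norm S + norm (blinfun_apply S (\<psi> n) - s *\<^sub>C \<psi> n)) \<longlonglongrightarrow> norm S + norm (0 :: 'b)"
    using assms unfolding approx_eigenvalue_def by (intro tendsto_intros)
  have "cmod s \<le> norm S + norm (blinfun_apply S (\<psi> n) - s *\<^sub>C \<psi> n)" for n
    using norm_triangle_ineq3[of "s *\<^sub>C \<psi> n" "blinfun_apply S (\<psi> n)"] norm_blinfun[of S "\<psi> n"]
    by (simp add: norm_scaleC unit norm_minus_commute)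
  then show "\<exists>N. \<forall>n\<ge>N. cmod s \<le> norm S + norm (blinfun_apply S (\<psi> n) - s *\<^sub>C \<psi> n)" by blast
  qed
  then show ?thesis by simp
qed

lemma approx_eigenvalue_unique:
  assumes "approx_eigenvalue \<psi> S s" "approx_eigenvalue \<psi> S t"
  shows "s = t"
proof -
  have "approx_eigenvalue \<psi> (S + (- 1) *\<^sub>R S) (s + (- 1) *\<^sub>R t)"
    by (intro approx_eigenvalue_add approx_eigenvalue_scaleR assms)
  then have "cmod (s + (- 1) *\<^sub>R t) \<le> norm (S + (- 1) *\<^sub>R S)"
    by (rule approx_eigenvalue_norm_le)
  then show ?thesis by simp
qed

lemma approx_eigenvalue_log1p:
  assumes "approx_eigenvalue \<psi> S s" "S \<in> bounded_ops" "norm S < 1"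
  shows "approx_eigenvalue \<psi> (op_log1p S) (Ln (1 + s))"
proof (rule approx_eigenvalue_sums[OF _ op_log1p_sums[OF assms(3)]])
  show "approx_eigenvalue \<psi> (((-1) ^ k / real (Suc k)) *\<^sub>R op_power S (Suc k))
      (((-1) ^ k / real (Suc k)) *\<^sub>R s ^ Suc k)" for k
    by (intro approx_eigenvalue_scaleR approx_eigenvalue_power assms(1,2))
  have "cmod s < 1" using approx_eigenvalue_norm_le[OF assms(1)] assms(3) by simp
  from Ln_series[OF this]
  have "(\<lambda>k. (-1) ^ Suc (Suc k) / of_nat (Suc k) * s ^ Suc k) sums Ln (1 + s)"
    by (subst sums_Suc_iff) simp
  then show "(\<lambda>k. ((-1) ^ k / real (Suc k)) *\<^sub>R s ^ Suc k) sums Ln (1 + s)"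
    by (simp add: scaleR_conv_of_real)
qed

lemma approx_eigenvalue_inner:
  assumes "approx_eigenvalue \<psi> S s"
  shows "(\<lambda>n. inner (blinfun_apply S (\<psi> n)) (\<psi> n)) \<longlonglongrightarrow> Re s"
proof -
  have inner_s: "inner (s *\<^sub>C \<psi> n) (\<psi> n) = Re s" for n
  proof -
    have "Im (cinner (\<psi> n) (\<psi> n)) = 0"
      using cinner_commute[of "\<psi> n" "\<psi> n"] by (metis complex_cnj_cancel_iff cnj.sel(2) neg_equal_zero)
    moreover have "Re (cinner (\<psi> n) (\<psi> n)) = 1"
      using unit[of n] by (simp add: inner_eq_Re_cinner[symmetric] dot_square_norm)
    ultimately show ?thesis by (simp add: inner_eq_Re_cinner cinner_scaleC_left)
  qed
  have "(\<lambda>n. inner (blinfun_apply S (\<psi> n) - s *\<^sub>C \<psi> n) (\<psi> n)) \<longlonglongrightarrow> 0"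
  proof (rule Lim_null_comparison)
    show "\<forall>\<^sub>F n in sequentially. norm (inner (blinfun_apply S (\<psi> n) - s *\<^sub>C \<psi> n) (\<psi> n))
        \<le> norm (blinfun_apply S (\<psi> n) - s *\<^sub>C \<psi> n)"
    proof (intro always_eventually allI)
      show "norm (inner (blinfun_apply S (\<psi> n) - s *\<^sub>C \<psi> n) (\<psi> n)) \<le> norm (blinfun_apply S (\<psi> n) - s *\<^sub>C \<psi> n)" for n
        using Cauchy_Schwarz_ineq2[of "blinfun_apply S (\<psi> n) - s *\<^sub>C \<psi> n" "\<psi> n"] by (simp add: unit)
    qed
    show "(\<lambda>n. norm (blinfun_apply S (\<psi> n) - s *\<^sub>C \<psi> n)) \<longlonglongrightarrow> 0"
      using assms by (simp add: approx_eigenvalue_def tendsto_norm_zero_iff)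
  qed
  then have "(\<lambda>n. inner (blinfun_apply S (\<psi> n)) (\<psi> n) - Re s) \<longlonglongrightarrow> 0"
    by (simp add: inner_diff_left inner_s)
  then show ?thesis by (simp add: LIM_zero_iff)
qed

end

text \<open>
Let \<open>\<nu> = \<parallel>Z\<parallel>\<close>. A unit vector \<open>x\<close> with \<open>\<parallel>Z x\<parallel>\<close> close to \<open>\<nu>\<close> nearly satisfies \<open>Z\<^sup>2 x = - \<nu>\<^sup>2 x\<close>.
Since \<open>Z\<^sup>2 + \<nu>\<^sup>2 = (Z - \<i> \<nu>) (Z + \<i> \<nu>)\<close>, both \<open>Z x + \<i> \<nu> x\<close> and \<open>Z x - \<i> \<nu> x\<close> are nearly
eigenvectors, for \<open>\<i> \<nu>\<close> and \<open>- \<i> \<nu>\<close> respectively, and by the parallelogram identity one of them has norm at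
least \<open>\<nu>\<close>. One of the two signs must occur for arbitrarily small errors.
\<close>

lemma skew_approx_eigenvalue:
  fixes Z :: "'b::complex_hilbert op"
  assumes Z: "Z \<in> bounded_ops" and skew: "\<And>x y. inner (blinfun_apply Z x) y = - inner x (blinfun_apply Z y)"
    and "Z \<noteq> 0"
  obtains l \<psi> where "\<bar>l\<bar> = norm Z" "\<And>n. norm (\<psi> n) = 1" "approx_eigenvalue \<psi> Z (\<i> * of_real l)"
proof -
  define \<nu> where "\<nu> = norm Z"
  have \<nu>: "\<nu> > 0" using \<open>Z \<noteq> 0\<close> by (simp add: \<nu>_def)
  define R where "R s \<phi> = blinfun_apply Z \<phi> - (\<i> * of_real s) *\<^sub>C \<phi>" for s \<phi>
  define P where "P s e \<longleftrightarrow> (\<exists>\<phi>. norm \<phi> = 1 \<and> norm (R s \<phi>) < e)" for s e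
  have either: "P \<nu> e \<or> P (- \<nu>) e" if "e > 0" for e
  proof -
    define b where "b = sqrt (max 0 (\<nu>\<^sup>2 - e\<^sup>2 / 4))"
    have "b < sqrt (\<nu>\<^sup>2)" unfolding b_def using \<nu> \<open>e > 0\<close> by (intro real_sqrt_less_mono) auto
    then have "b < \<nu>" using \<nu> by simp
    moreover have "0 \<le> b" by (simp add: b_def)
    ultimately have "\<not> (\<forall>y. norm (blinfun_apply Z y) \<le> b * norm y)"
      using norm_blinfun_bound[of b Z] by (auto simp: \<nu>_def)
    then obtain y where y: "norm (blinfun_apply Z y) > b * norm y" by (auto simp: not_le)
    then have "y \<noteq> 0" by auto
    define x where "x = y /\<^sub>R norm y"
    have x: "norm x = 1" using \<open>y \<noteq> 0\<close> by (simp add: x_def)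
    have "b < norm (blinfun_apply Z x)"
      using y \<open>y \<noteq> 0\<close> by (simp add: x_def blinfun.scaleR_right field_simps)
    then have "b\<^sup>2 < (norm (blinfun_apply Z x))\<^sup>2" using \<open>0 \<le> b\<close> by (intro power_strict_mono) auto
    then have large: "\<nu>\<^sup>2 - e\<^sup>2 / 4 < (norm (blinfun_apply Z x))\<^sup>2" by (simp add: b_def)
    define w where "w = blinfun_apply Z (blinfun_apply Z x) + \<nu>\<^sup>2 *\<^sub>R x"
    have w: "norm w < \<nu> * e"
    proof -
      have "norm (blinfun_apply Z (blinfun_apply Z x)) \<le> \<nu> * (\<nu> * norm x)"
        using norm_blinfun[of Z "blinfun_apply Z x"] norm_blinfun[of Z x] \<nu>
        unfolding \<nu>_def by (meson mult_left_mono norm_ge_zero order_trans)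
      then have ZZ: "(norm (blinfun_apply Z (blinfun_apply Z x)))\<^sup>2 \<le> (\<nu> * \<nu>)\<^sup>2"
        using x by (intro power_mono) auto
      have "(norm (a + c *\<^sub>R x))\<^sup>2 = (norm a)\<^sup>2 + 2 * c * inner a x + c\<^sup>2 * (norm x)\<^sup>2" for a c
        unfolding power2_norm_eq_inner
        by (simp add: inner_add_left inner_add_right inner_commute power2_eq_square)
      then have "(norm w)\<^sup>2 = (norm (blinfun_apply Z (blinfun_apply Z x)))\<^sup>2
          + 2 * \<nu>\<^sup>2 * inner (blinfun_apply Z (blinfun_apply Z x)) x + (\<nu> * \<nu>)\<^sup>2"
        by (simp add: w_def x power2_eq_square)
      also have "inner (blinfun_apply Z (blinfun_apply Z x)) x = - (norm (blinfun_apply Z x))\<^sup>2"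
        unfolding skew[of "blinfun_apply Z x" x] power2_norm_eq_inner ..
      finally have "(norm w)\<^sup>2 = (norm (blinfun_apply Z (blinfun_apply Z x)))\<^sup>2
          - 2 * \<nu>\<^sup>2 * (norm (blinfun_apply Z x))\<^sup>2 + (\<nu> * \<nu>)\<^sup>2" by simp
      also have "\<dots> \<le> 2 * \<nu>\<^sup>2 * (\<nu>\<^sup>2 - (norm (blinfun_apply Z x))\<^sup>2)"
      proof -
        have "2 * \<nu>\<^sup>2 * (\<nu>\<^sup>2 - (norm (blinfun_apply Z x))\<^sup>2)
            = (\<nu> * \<nu>)\<^sup>2 - 2 * \<nu>\<^sup>2 * (norm (blinfun_apply Z x))\<^sup>2 + (\<nu> * \<nu>)\<^sup>2"
          by (simp add: power2_eq_square right_diff_distrib)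
        then show ?thesis using ZZ by linarith
      qed
      also have "\<dots> < 2 * \<nu>\<^sup>2 * (e\<^sup>2 / 4)"
        using large \<nu> by (intro mult_strict_left_mono) auto
      also have "\<dots> \<le> (\<nu> * e)\<^sup>2" by (simp add: power_mult_distrib)
      finally show ?thesis using \<nu> \<open>e > 0\<close> by (simp add: power2_less_imp_less)
    qed
    \<comment> \<open>The candidate for the eigenvalue \<open>\<i> s\<close>, where \<open>s\<close> is \<open>\<nu>\<close> or \<open>- \<nu>\<close>.\<close>
    define \<phi> where "\<phi> s = blinfun_apply Z x + (\<i> * of_real s) *\<^sub>C x" for s :: real
    have factor: "R s (\<phi> s) = w" if "s\<^sup>2 = \<nu>\<^sup>2" for s
    proof -
      have "(\<i> * of_real s) *\<^sub>C (\<i> * of_real s) *\<^sub>C x = - (s\<^sup>2 *\<^sub>R x)"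
      proof -
        have "\<i> * of_real s * (\<i> * of_real s) = - complex_of_real (s\<^sup>2)"
          by (simp add: complex_eq_iff power2_eq_square)
        then show ?thesis by (simp only: scaleC_scaleC scaleC_minus_left scaleR_scaleC)
      qed
      then show ?thesis
        by (simp add: R_def \<phi>_def w_def blinfun.add_right bounded_opsD[OF Z] scaleC_add_right that)
    qed
    have good: "P s e" if "s\<^sup>2 = \<nu>\<^sup>2" "\<nu> \<le> norm (\<phi> s)" for s
      unfolding P_def
    proof (intro exI conjI)
      have "norm (\<phi> s) > 0" using that \<nu> by linarith
      then show "norm (\<phi> s /\<^sub>R norm (\<phi> s)) = 1" by simp
      have "R s (\<phi> s /\<^sub>R norm (\<phi> s)) = w /\<^sub>R norm (\<phi> s)"
        unfolding factor[OF that(1), symmetric]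
        by (simp add: R_def blinfun.scaleR_right scaleR_diff_right
            linear_scale[OF bounded_linear.linear[OF bounded_linear_scaleC_right]])
      also have "norm \<dots> = norm w / norm (\<phi> s)" by (simp add: divide_inverse mult.commute)
      also have "\<dots> < e"
      proof -
        have "norm w < \<nu> * e" by (rule w)
        also have "\<dots> \<le> norm (\<phi> s) * e" using that \<open>e > 0\<close> by simp
        finally show ?thesis using \<open>norm (\<phi> s) > 0\<close> by (simp add: pos_divide_less_eq mult.commute)
      qed
      finally show "norm (R s (\<phi> s /\<^sub>R norm (\<phi> s))) < e" .
    qed
    have minus: "\<phi> (- \<nu>) = blinfun_apply Z x - (\<i> * of_real \<nu>) *\<^sub>C x"
      by (simp add: \<phi>_def scaleC_minus_left)
    have "(norm (\<phi> \<nu>))\<^sup>2 + (norm (\<phi> (- \<nu>)))\<^sup>2 = 2 * ((norm (blinfun_apply Z x))\<^sup>2 + \<nu>\<^sup>2)"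
    proof -
      have "norm ((\<i> * of_real \<nu>) *\<^sub>C x) = \<nu>" using x \<nu> by (simp add: norm_scaleC norm_mult)
      moreover have "(norm (a + b))\<^sup>2 + (norm (a - b))\<^sup>2 = 2 * ((norm a)\<^sup>2 + (norm b)\<^sup>2)" for a b :: 'b
        unfolding power2_norm_eq_inner
        by (simp add: inner_add_left inner_add_right inner_diff_left inner_diff_right)
      ultimately show ?thesis unfolding minus unfolding \<phi>_def by simp
    qed
    then have sum_ge: "2 * \<nu>\<^sup>2 \<le> (norm (\<phi> \<nu>))\<^sup>2 + (norm (\<phi> (- \<nu>)))\<^sup>2" by simp
    have "\<nu> \<le> norm (\<phi> \<nu>) \<or> \<nu> \<le> norm (\<phi> (- \<nu>))"
    proof (rule ccontr)
      assume "\<not> ?thesis"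
      then have "(norm (\<phi> \<nu>))\<^sup>2 < \<nu>\<^sup>2" "(norm (\<phi> (- \<nu>)))\<^sup>2 < \<nu>\<^sup>2"
        by (auto intro!: power_strict_mono)
      with sum_ge show False by linarith
    qed
    then show ?thesis using good[of \<nu>] good[of "- \<nu>"] by auto
  qed
  have mono: "P s d" if "P s e" "e \<le> d" for s d e
    using that unfolding P_def by (meson less_le_trans)
  have "(\<forall>e>0. P \<nu> e) \<or> (\<forall>e>0. P (- \<nu>) e)"
  proof (rule ccontr)
    assume "\<not> ?thesis"
    then obtain d e where "d > 0" "\<not> P \<nu> d" "e > 0" "\<not> P (- \<nu>) e" by blast
    then show False using either[of "min d e"] mono[of _ "min d e"] by auto
  qed
  then obtain l where l: "\<bar>l\<bar> = \<nu>" "\<And>e. e > 0 \<Longrightarrow> P l e" using \<nu> by (metis abs_minus_cancel abs_of_pos)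
  then have "\<exists>\<phi>. norm \<phi> = 1 \<and> norm (R l \<phi>) < inverse (real (Suc n))" for n
    unfolding P_def by simp
  then obtain \<psi> where \<psi>: "\<And>n. norm (\<psi> n) = 1" "\<And>n. norm (R l (\<psi> n)) < inverse (real (Suc n))"
    by metis
  have "(\<lambda>n. R l (\<psi> n)) \<longlonglongrightarrow> 0"
    by (rule Lim_null_comparison[OF _ LIMSEQ_inverse_real_of_nat])
      (use \<psi>(2) in \<open>auto intro: always_eventually less_imp_le\<close>)
  then show thesis using that[of l \<psi>] l(1) \<psi>(1) by (simp add: approx_eigenvalue_def R_def \<nu>_def)
qed

text \<open>
Let \<open>\<i> l\<close> with \<open>\<bar>l\<bar> = \<parallel>Z\<parallel>\<close> be an approximate eigenvalue of \<open>Z = log U\<close>, and hence \<open>u = exp(\<i> l)\<close> one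
of \<open>U\<close>. Reading \<open>Z\<close> as a series in \<open>U - 1\<close> shows \<open>Ln u = \<i> l\<close>, and \<open>\<bar>u - 1\<bar> < 1\<close> then confines \<open>l\<close> to
the interval on which \<open>arccos (cos l) = \<bar>l\<bar>\<close>. So the angles between the approximate eigenvectors and
their images under \<open>U\<close> tend to \<open>\<parallel>Z\<parallel>\<close>.
\<close>

lemma norm_log_le_angle:
  fixes U :: "'b::complex_hilbert op"
  assumes U: "U \<in> bounded_ops" "norm (U - id_blinfun) < 1" "norm U \<le> 1"
    and skew: "\<And>x y. inner (blinfun_apply (op_log1p (U - id_blinfun)) x) y
      = - inner x (blinfun_apply (op_log1p (U - id_blinfun)) y)"
    and "0 \<le> L" and angle: "\<And>x. norm x = 1 \<Longrightarrow> arccos (inner (blinfun_apply U x) x) \<le> L"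
  shows "norm (op_log1p (U - id_blinfun)) \<le> L"
proof (cases "op_log1p (U - id_blinfun) = 0")
  case False
  let ?Z = "op_log1p (U - id_blinfun)"
  have diff: "U - id_blinfun \<in> bounded_ops" using U by (simp add: bounded_ops_diff)
  have Z: "?Z \<in> bounded_ops" by (rule bounded_ops_log1p[OF diff U(2)])
  obtain l \<psi> where l: "\<bar>l\<bar> = norm ?Z" and unit: "\<And>n. norm (\<psi> n) = 1"
    and ae: "approx_eigenvalue \<psi> ?Z (\<i> * of_real l)"
    using skew_approx_eigenvalue[OF Z skew False] by blast
  define u where "u = exp (\<i> * of_real l)"
  have "approx_eigenvalue \<psi> (op_exp ?Z) u"
    unfolding u_def by (rule approx_eigenvalue_exp[OF unit ae Z])
  then have ae_U: "approx_eigenvalue \<psi> U u" by (simp add: op_exp_log1p[OF U(2)])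
  have ae_diff: "approx_eigenvalue \<psi> (U - id_blinfun) (u - 1)"
    using approx_eigenvalue_add[OF ae_U approx_eigenvalue_scaleR[OF approx_eigenvalue_id, where r = "-1"]]
    by simp
  have "approx_eigenvalue \<psi> ?Z (Ln u)"
    using approx_eigenvalue_log1p[OF unit ae_diff diff U(2)] by simp
  then have "Ln u = \<i> * of_real l" using approx_eigenvalue_unique[OF unit _ ae] by blast
  moreover have "cmod (u - 1) < 1"
    using approx_eigenvalue_norm_le[OF unit ae_diff] U(2) by simp
  then have "0 < Re u" using abs_Re_le_cmod[of "u - 1"] by simp
  ultimately have "\<bar>l\<bar> < pi / 2" using Re_Ln_pos_lt[of u] by (auto simp: u_def)
  then have "arccos (Re u) = \<bar>l\<bar>"
    using arccos_cos[of "\<bar>l\<bar>"] by (simp add: u_def Re_exp)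
  moreover have "arccos (Re u) \<le> L"
  proof (rule LIMSEQ_le_const2)
    have bound: "\<bar>inner (blinfun_apply U (\<psi> n)) (\<psi> n)\<bar> \<le> 1" for n
      using Cauchy_Schwarz_ineq2[of "blinfun_apply U (\<psi> n)" "\<psi> n"] norm_blinfun[of U "\<psi> n"] U(3)
      by (simp add: unit)
    show "(\<lambda>n. arccos (inner (blinfun_apply U (\<psi> n)) (\<psi> n))) \<longlonglongrightarrow> arccos (Re u)"
    proof (rule continuous_on_tendsto_compose[OF continuous_on_arccos' approx_eigenvalue_inner[OF unit ae_U]])
      show "Re u \<in> {- 1..1}" by (simp add: u_def Re_exp)
      show "\<forall>\<^sub>F n in sequentially. inner (blinfun_apply U (\<psi> n)) (\<psi> n) \<in> {- 1..1}"
        using bound by (auto simp: abs_le_iff minus_le_iff intro!: always_eventually)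
    qed
    show "\<exists>N. \<forall>n\<ge>N. arccos (inner (blinfun_apply U (\<psi> n)) (\<psi> n)) \<le> L"
      using angle[OF unit] by blast
  qed
  ultimately show ?thesis using l by simp
qed (simp add: \<open>0 \<le> L\<close>)

section \<open>Orthogonal projections and minimality\<close>

definition adjoint_pair :: "'b::real_inner \<Rightarrow>\<^sub>L 'b \<Rightarrow> 'b \<Rightarrow>\<^sub>L 'b \<Rightarrow> bool"
  where "adjoint_pair B C \<longleftrightarrow> (\<forall>x y. inner (blinfun_apply B x) y = inner x (blinfun_apply C y))"

lemma adjoint_pairD: "adjoint_pair B C \<Longrightarrow> inner (blinfun_apply B x) y = inner x (blinfun_apply C y)"
  by (simp add: adjoint_pair_def)

lemma adjoint_pair_id: "adjoint_pair id_blinfun id_blinfun"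
  and adjoint_pair_compose: "adjoint_pair B C \<Longrightarrow> adjoint_pair B' C' \<Longrightarrow> adjoint_pair (B o\<^sub>L B') (C' o\<^sub>L C)"
  and adjoint_pair_scaleR: "adjoint_pair B C \<Longrightarrow> adjoint_pair (r *\<^sub>R B) (r *\<^sub>R C)"
  and adjoint_pair_diff: "adjoint_pair B C \<Longrightarrow> adjoint_pair B' C' \<Longrightarrow> adjoint_pair (B - B') (C - C')"
  by (simp_all add: adjoint_pair_def blinfun.bilinear_simps inner_diff_left inner_diff_right)

lemma op_power_commutes: "op_power B n o\<^sub>L B = B o\<^sub>L op_power B n"
  by (induction n) (simp_all add: op_comp_assoc)

lemma adjoint_pair_power: "adjoint_pair B C \<Longrightarrow> adjoint_pair (op_power B n) (op_power C n)"
proof (induction n)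
  case (Suc n)
  then have "adjoint_pair (B o\<^sub>L op_power B n) (op_power C n o\<^sub>L C)"
    by (intro adjoint_pair_compose) auto
  then show ?case by (simp add: op_power_commutes)
qed (simp add: adjoint_pair_id)

lemma adjoint_pair_sums:
  fixes B C :: "nat \<Rightarrow> 'b::real_inner \<Rightarrow>\<^sub>L 'b"
  assumes pair: "\<And>n. adjoint_pair (B n) (C n)" and sums: "B sums D" "C sums E"
  shows "adjoint_pair D E"
  unfolding adjoint_pair_def
proof (intro allI)
  fix x y
  have "(\<lambda>n. inner (blinfun_apply (B n) x) y) sums inner (blinfun_apply D x) y"
    by (intro bounded_linear.sums[OF bounded_linear_inner_left] bounded_linear.sums[OF blinfun.bounded_linear_left] sums)
  moreover have "(\<lambda>n. inner x (blinfun_apply (C n) y)) sums inner x (blinfun_apply E y)"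
    by (intro bounded_linear.sums[OF bounded_linear_inner_right] bounded_linear.sums[OF blinfun.bounded_linear_left] sums)
  ultimately show "inner (blinfun_apply D x) y = inner x (blinfun_apply E y)"
    unfolding adjoint_pairD[OF pair] by (rule sums_unique2)
qed

lemma adjoint_pair_exp: "adjoint_pair B C \<Longrightarrow> adjoint_pair (op_exp B) (op_exp C)"
  by (rule adjoint_pair_sums[OF _ op_exp_sums op_exp_sums])
    (intro adjoint_pair_scaleR adjoint_pair_power)

lemma adjoint_pair_log1p:
  assumes "adjoint_pair B C" "norm B < 1" "norm C < 1"
  shows "adjoint_pair (op_log1p B) (op_log1p C)"
  by (rule adjoint_pair_sums[OF _ op_log1p_sums op_log1p_sums])
    (intro adjoint_pair_scaleR adjoint_pair_power assms)+

lemma adjoint_pair_eps: "adjoint_pair P P \<Longrightarrow> adjoint_pair (eps P) (eps P)"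
  unfolding eps_def by (intro adjoint_pair_diff adjoint_pair_scaleR adjoint_pair_id)

lemma isometry_of_adjoint_inverse:
  assumes "adjoint_pair B C" "C o\<^sub>L B = id_blinfun"
  shows "norm (blinfun_apply B x) = norm x"
proof -
  have "blinfun_apply C (blinfun_apply B x) = x"
    using arg_cong[OF assms(2), of "\<lambda>D. blinfun_apply D x"] by simp
  then show ?thesis by (simp add: norm_eq_sqrt_inner adjoint_pairD[OF assms(1)])
qed

lemma norm_le_1_of_adjoint_inverse:
  assumes "adjoint_pair B C" "C o\<^sub>L B = id_blinfun"
  shows "norm B \<le> 1"
  by (rule norm_blinfun_bound) (simp_all add: isometry_of_adjoint_inverse[OF assms])

lemma
  fixes P :: "'b::complex_hilbert op"
  assumes "P o\<^sub>L P = P" "adjoint_pair P P"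
  shows norm_reflection_apply: "norm (blinfun_apply (eps P) x) = norm x"
    and norm_reflection_le_1: "norm (eps P) \<le> 1"
  using isometry_of_adjoint_inverse[OF adjoint_pair_eps eps_square]
    norm_le_1_of_adjoint_inverse[OF adjoint_pair_eps eps_square] assms by blast+

text \<open>
An involution \<open>S\<close> satisfies \<open>S = S\<^sup>3\<close>, so its norm cannot lie strictly between 0 and 1.
\<close>

lemma norm_eps_ge_1:
  assumes "Q o\<^sub>L Q = Q" "eps Q \<noteq> 0"
  shows "1 \<le> norm (eps Q)"
proof -
  have "norm (eps Q) = norm (eps Q o\<^sub>L (eps Q o\<^sub>L eps Q))" by (simp add: eps_square assms)
  also have "\<dots> \<le> norm (eps Q) * (norm (eps Q) * norm (eps Q))"
    by (meson norm_blinfun_compose mult_left_mono norm_ge_zero order_trans)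
  finally have "1 \<le> norm (eps Q) * norm (eps Q)" using assms by simp
  then show ?thesis by (metis linorder_not_le mult_strict_mono' norm_ge_zero mult_1)
qed

locale close_projections = close_idempotents Q R for Q R :: "'b::complex_hilbert op" +
  assumes Q_adj: "adjoint_pair Q Q" and R_adj: "adjoint_pair R R"
begin

text \<open>
Passing to adjoints exchanges \<open>eps R \<circ> eps Q\<close> and its inverse.
\<close>

lemma exponent_skew: "adjoint_pair X (- X)"
proof -
  have "adjoint_pair ((eps R o\<^sub>L eps Q) - id_blinfun) ((eps Q o\<^sub>L eps R) - id_blinfun)"
    by (intro adjoint_pair_diff adjoint_pair_compose adjoint_pair_eps adjoint_pair_id Q_adj R_adj)
  then have "adjoint_pair X (geodesic_exponent R Q)"
    unfolding geodesic_exponent_eq by (intro adjoint_pair_scaleR adjoint_pair_log1p norm_eps_prod_less)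
  then show ?thesis by (simp add: exponent_reversed)
qed

lemma exp_exponent_adjoint: "adjoint_pair (op_exp (t *\<^sub>R X)) (op_exp (- (t *\<^sub>R X)))"
  using adjoint_pair_exp[OF adjoint_pair_scaleR[OF exponent_skew, of t]] by simp

lemma exp_minus_exponent_adjoint: "adjoint_pair (op_exp (- (t *\<^sub>R X))) (op_exp (t *\<^sub>R X))"
  using exp_exponent_adjoint[of "- t"] by simp

lemma orbit_curve_self_adjoint: "adjoint_pair (orbit_curve Q X t) (orbit_curve Q X t)"
proof -
  have "adjoint_pair (orbit_curve Q X t) (op_exp (t *\<^sub>R X) o\<^sub>L (Q o\<^sub>L op_exp (- (t *\<^sub>R X))))"
    unfolding orbit_curve_def
    by (intro adjoint_pair_compose exp_exponent_adjoint exp_minus_exponent_adjoint Q_adj)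
  then show ?thesis by (simp add: orbit_curve_def op_comp_assoc)
qed

lemmas norm_eps_le_1 = norm_reflection_le_1[OF Q_idem Q_adj] norm_reflection_le_1[OF R_idem R_adj]

text \<open>
The velocity is conjugate to \<open>X \<circ> eps Q\<close> by the unitary operator \<open>exp (t X)\<close>.
\<close>

lemma norm_velocity_le: "norm (orbit_curve ((X o\<^sub>L Q) - (Q o\<^sub>L X)) X t) \<le> norm X"
proof -
  let ?E = "op_exp (t *\<^sub>R X)" and ?E' = "op_exp (- (t *\<^sub>R X))"
  have E: "norm ?E \<le> 1" "norm ?E' \<le> 1"
    by (rule norm_le_1_of_adjoint_inverse[OF exp_exponent_adjoint op_exp_minus_inverse'],
      rule norm_le_1_of_adjoint_inverse[OF exp_minus_exponent_adjoint op_exp_minus_inverse])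
  have "norm (orbit_curve (X o\<^sub>L eps Q) X t) \<le> norm (?E o\<^sub>L (X o\<^sub>L eps Q)) * norm ?E'"
    unfolding orbit_curve_def by (rule norm_blinfun_compose)
  also have "\<dots> \<le> (norm ?E * norm (X o\<^sub>L eps Q)) * norm ?E'"
    by (intro mult_right_mono norm_blinfun_compose) simp
  also have "\<dots> \<le> (1 * (norm X * norm (eps Q))) * 1"
    using E by (intro mult_mono norm_blinfun_compose) auto
  also have "\<dots> \<le> norm X" using norm_eps_le_1(1) by (simp add: mult_left_le)
  finally show ?thesis by (simp add: commutator_eq)
qed

lemma norm_exponent_le_angle:
  assumes "0 \<le> L"
    and "\<And>x. norm x = 1 \<Longrightarrow> arccos (inner (blinfun_apply (eps R o\<^sub>L eps Q) x) x) \<le> 2 * L"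
  shows "norm X \<le> L"
proof -
  let ?U = "eps R o\<^sub>L eps Q"
  have Z: "op_log1p (?U - id_blinfun) = 2 *\<^sub>R X" by (simp add: geodesic_exponent_eq)
  have "norm ?U \<le> norm (eps R) * norm (eps Q)" by (rule norm_blinfun_compose)
  also have "\<dots> \<le> 1 * 1" using norm_eps_le_1 by (intro mult_mono) auto
  finally have U: "norm ?U \<le> 1" by simp
  have "inner (blinfun_apply (op_log1p (?U - id_blinfun)) x) y
      = - inner x (blinfun_apply (op_log1p (?U - id_blinfun)) y)" for x y
    unfolding Z using adjoint_pairD[OF adjoint_pair_scaleR[OF exponent_skew, of 2]]
    by (simp add: blinfun.minus_left)
  then have "norm (op_log1p (?U - id_blinfun)) \<le> 2 * L"
    using assms U by (intro norm_log_le_angle bounded_ops_compose bounded_ops_eps Q_bounded R_bounded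
        norm_eps_prod_less) auto
  then show ?thesis by (simp add: Z)
qed

end

context energy_completion
begin

lemma extension_diff:
  assumes "B \<in> symmetric_ops A" "C \<in> symmetric_ops A"
  shows "extension J (B - C) = extension J B - extension J C"
  by (intro extension_eq extends_diff extends_extension assms)

lemma extension_scaleR:
  assumes "B \<in> symmetric_ops A"
  shows "extension J (r *\<^sub>R B) = r *\<^sub>R extension J B"
  by (intro extension_eq extends_scaleR extends_extension assms)

lemma extension_lipschitz:
  assumes "B \<in> symmetric_ops A" "C \<in> symmetric_ops A"
  shows "norm (extension J B - extension J C) \<le> norm (B - C)"
  using norm_extension_le[OF subspace_diff[OF subspace_symmetric_ops assms]]
  by (simp add: extension_diff assms)

lemma continuous_on_extension: "continuous_on (symmetric_ops A) (extension J)"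
  unfolding continuous_on_iff dist_norm
  using extension_lipschitz by (meson le_less_trans)

lemma continuous_on_finsler: "continuous_on (symmetric_ops A) (finsler J)"
  unfolding finsler_def[abs_def] by (intro continuous_on_norm continuous_on_extension)

text \<open>
The extension map is linear and does not increase norms on symmetric operators. These form a closed
subspace, so velocities stay inside and difference quotients may be extended term by term.
\<close>

lemma extension_has_vector_derivative:
  assumes sym: "\<And>s. s \<in> {a..b} \<Longrightarrow> \<gamma> s \<in> symmetric_ops A" and "a < b" "t \<in> {a..b}"
    and der: "(\<gamma> has_vector_derivative d) (at t within {a..b})"
  shows "((\<lambda>s. extension J (\<gamma> s)) has_vector_derivative extension J d) (at t within {a..b})"
proof -
  have d: "d \<in> symmetric_ops A"
    by (rule vector_derivative_in_closed_subspace[OF subspace_symmetric_ops closed_symmetric_ops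
          \<open>a < b\<close> \<open>t \<in> {a..b}\<close> sym der])
  have "((\<lambda>s. norm (extension J (\<gamma> s) - extension J (\<gamma> t) - (s - t) *\<^sub>R extension J d) / norm (s - t))
      \<longlongrightarrow> 0) (at t within {a..b})"
  proof (rule Lim_null_comparison)
    show "((\<lambda>s. norm (\<gamma> s - \<gamma> t - (s - t) *\<^sub>R d) / norm (s - t)) \<longlongrightarrow> 0) (at t within {a..b})"
      using der by (simp add: has_vector_derivative_def has_derivative_iff_norm)
    have "norm (extension J (\<gamma> s) - extension J (\<gamma> t) - (s - t) *\<^sub>R extension J d)
        \<le> norm (\<gamma> s - \<gamma> t - (s - t) *\<^sub>R d)" if "s \<in> {a..b}" for s
    proof -
      note mem = sym[OF that] sym[OF \<open>t \<in> {a..b}\<close>] d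
        subspace_diff[OF subspace_symmetric_ops] subspace_scale[OF subspace_symmetric_ops]
      have "extension J (\<gamma> s) - extension J (\<gamma> t) - (s - t) *\<^sub>R extension J d
          = extension J (\<gamma> s - \<gamma> t - (s - t) *\<^sub>R d)"
        by (simp add: extension_diff extension_scaleR mem)
      then show ?thesis by (simp add: norm_extension_le mem)
    qed
    then show "\<forall>\<^sub>F s in at t within {a..b}.
        norm (norm (extension J (\<gamma> s) - extension J (\<gamma> t) - (s - t) *\<^sub>R extension J d) / norm (s - t))
        \<le> norm (\<gamma> s - \<gamma> t - (s - t) *\<^sub>R d) / norm (s - t)"
      by (auto simp: eventually_at_filter divide_right_mono intro!: always_eventually)
  qed
  then show ?thesis
    by (simp add: has_vector_derivative_def has_derivative_iff_norm bounded_linear_scaleR_left)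
qed

lemma GrD: "Q \<in> Gr A \<Longrightarrow> Q \<in> symmetric_ops A" "Q \<in> Gr A \<Longrightarrow> Q o\<^sub>L Q = Q" "Q \<in> Gr A \<Longrightarrow> Q \<in> bounded_ops"
  by (auto simp: Gr_def idempotents_def)

lemma extension_projection:
  assumes "Q \<in> Gr A"
  shows "extension J Q o\<^sub>L extension J Q = extension J Q" "extension J Q \<in> bounded_ops"
    "adjoint_pair (extension J Q) (extension J Q)"
proof -
  note ext = extends_extension[OF GrD(1)[OF assms]]
  show "extension J Q o\<^sub>L extension J Q = extension J Q"
    using extends_unique[OF extends_compose[OF ext ext]] ext by (simp add: GrD(2)[OF assms])
  show "extension J Q \<in> bounded_ops" using ext by (simp add: extends_def)
  show "adjoint_pair (extension J Q) (extension J Q)"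
    unfolding adjoint_pair_def using extension_symmetric[OF GrD(1)[OF assms]] by blast
qed

lemma norm_eps_extension: "Q \<in> Gr A \<Longrightarrow> norm (blinfun_apply (eps (extension J Q)) x) = norm x"
  by (rule norm_reflection_apply[OF extension_projection(1,3)])

lemma speed_integrable:
  assumes "joining_curve A Q\<^sub>0 Q\<^sub>1 \<gamma>"
  shows "(\<lambda>t. finsler J (vector_derivative \<gamma> (at t within {0..1}))) integrable_on {0..1}"
  using assms GrD(1) unfolding joining_curve_def
  by (intro piecewise_smooth_speed_integrable[OF _ subspace_symmetric_ops closed_symmetric_ops _ continuous_on_finsler])
    auto

text \<open>
The path \<open>eps (P(t)) (eps P\<^sub>0 x)\<close> on the unit sphere, with \<open>P(t)\<close> the extension of \<open>\<gamma> t\<close>, starts at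
\<open>x\<close> because \<open>eps P\<^sub>0\<close> is an involution. Its velocity is \<open>2 P'(t) (eps P\<^sub>0 x)\<close>.
\<close>

lemma angle_le_curve_length:
  assumes curve: "joining_curve A Q\<^sub>0 Q\<^sub>1 \<gamma>" and "norm x = 1"
  shows "arccos (inner (blinfun_apply (eps (extension J Q\<^sub>1) o\<^sub>L eps (extension J Q\<^sub>0)) x) x)
    \<le> 2 * curve_length J \<gamma>"
proof -
  have pw: "piecewise_smooth \<gamma>" and Gr: "\<And>t. t \<in> {0..1} \<Longrightarrow> \<gamma> t \<in> Gr A"
    and ends: "\<gamma> 0 = Q\<^sub>0" "\<gamma> 1 = Q\<^sub>1"
    using curve by (auto simp: joining_curve_def)
  have Q0: "Q\<^sub>0 \<in> Gr A" using Gr[of 0] ends by simp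
  obtain S where S: "finite S" and cont: "continuous_on {0..1} \<gamma>"
    and der: "\<And>t. t \<in> {0<..<1} - S \<Longrightarrow> (\<gamma> has_vector_derivative vector_derivative \<gamma> (at t)) (at t)"
    using piecewise_smooth_continuous_derivative[OF pw] by blast
  define y where "y = blinfun_apply (eps (extension J Q\<^sub>0)) x"
  have y: "norm y = 1" by (simp add: y_def norm_eps_extension Q0 \<open>norm x = 1\<close>)
  have cancel: "blinfun_apply (eps (extension J Q\<^sub>0)) y = x"
    using arg_cong[OF eps_square[OF extension_projection(1)[OF Q0]], of "\<lambda>D. blinfun_apply D x"]
    by (simp add: y_def)
  define u where "u t = blinfun_apply (eps (extension J (\<gamma> t))) y" for t
  define v where "v t = 2 * finsler J (vector_derivative \<gamma> (at t within {0..1}))" for t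
  have u_eq: "u = (\<lambda>t. 2 *\<^sub>R blinfun_apply (extension J (\<gamma> t)) y - y)"
    by (simp add: u_def fun_eq_iff eps_apply)
  have "arccos (inner (u 1) (u 0)) \<le> integral {0..1} v"
  proof (rule sphere_distance_le_length[OF S])
    have "continuous_on {0..1} (\<lambda>t. extension J (\<gamma> t))"
      using Gr GrD(1) by (intro continuous_on_compose2[OF continuous_on_extension cont]) auto
    then show "continuous_on {0..1} u"
      unfolding u_eq by (intro continuous_intros)
    show "norm (u t) = 1" if "t \<in> {0..1}" for t
      by (simp add: u_def norm_eps_extension Gr[OF that] y)
    fix t assume t: "t \<in> {0<..<1} - S"
    let ?d = "vector_derivative \<gamma> (at t)"
    have "((\<lambda>s. extension J (\<gamma> s)) has_vector_derivative extension J ?d) (at t within {0..1})"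
      using Gr GrD(1) t by (intro extension_has_vector_derivative has_vector_derivative_at_within[OF der]) auto
    then have "((\<lambda>s. extension J (\<gamma> s)) has_vector_derivative extension J ?d) (at t)"
      using t by (simp add: at_within_Icc_at)
    then have "((\<lambda>s. blinfun_apply (extension J (\<gamma> s)) y) has_vector_derivative blinfun_apply (extension J ?d) y) (at t)"
      by (rule bounded_linear.has_vector_derivative[OF blinfun.bounded_linear_left])
    then show "(u has_vector_derivative 2 *\<^sub>R blinfun_apply (extension J ?d) y) (at t)"
      unfolding u_eq by (auto intro!: derivative_eq_intros)
    have "norm (blinfun_apply (extension J ?d) y) \<le> norm (extension J ?d)"
      using norm_blinfun[of "extension J ?d" y] by (simp add: y)
    then show "norm (2 *\<^sub>R blinfun_apply (extension J ?d) y) \<le> v t"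
      using t by (simp add: v_def finsler_def at_within_Icc_at)
  next
    show "v integrable_on {0..1}"
      unfolding v_def[abs_def] by (intro integrable_on_mult_right speed_integrable[OF curve])
  qed
  also have "integral {0..1} v = 2 * curve_length J \<gamma>"
    by (simp add: v_def[abs_def] curve_length_def)
  also have "u 0 = x" by (simp add: u_def ends cancel)
  also have "u 1 = blinfun_apply (eps (extension J Q\<^sub>1) o\<^sub>L eps (extension J Q\<^sub>0)) x"
    by (simp add: u_def ends y_def)
  finally show ?thesis .
qed

lemma extends_eps: "extends P Q \<Longrightarrow> extends (eps P) (eps Q)"
  unfolding eps_def by (intro extends_diff extends_scaleR extends_id)

lemma extends_orbit_curve:
  "extends P Q \<Longrightarrow> extends Y X \<Longrightarrow> extends (orbit_curve P Y t) (orbit_curve Q X t)"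
  unfolding orbit_curve_def
  by (intro extends_compose extends_op_exp extends_minus extends_scaleR)

lemma curve_length_nonneg:
  assumes "joining_curve A Q\<^sub>0 Q\<^sub>1 \<gamma>"
  shows "0 \<le> curve_length J \<gamma>"
  unfolding curve_length_def
  by (rule integral_nonneg[OF speed_integrable[OF assms]]) (simp add: finsler_def)

end

theorem proposition7p2:
  fixes A Q\<^sub>0 Q\<^sub>1 :: "'a::complex_hilbert \<Rightarrow>\<^sub>L 'a"
    and J :: "'a \<Rightarrow> 'b::complex_hilbert"
    and \<delta> :: "real \<Rightarrow> 'a \<Rightarrow>\<^sub>L 'a"
  assumes "A \<in> bounded_ops"
    and "positive_op A" and "positive_op (id_blinfun - A)"
    and "{f. blinfun_apply A f = 0} = {0}"
    and "hilbert_completion A J"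
    and "Q\<^sub>0 \<in> Gr A" and "Q\<^sub>1 \<in> Gr A"
    and "norm (Q\<^sub>0 - Q\<^sub>1) < geodesic_radius Q\<^sub>0"
    and "\<delta> = orbit_curve Q\<^sub>0 (geodesic_exponent Q\<^sub>0 Q\<^sub>1)"
  shows "idempotent_geodesic Q\<^sub>0 \<delta> \<and>
    joining_curve A Q\<^sub>0 Q\<^sub>1 \<delta> \<and>
    (\<forall>\<gamma>. joining_curve A Q\<^sub>0 Q\<^sub>1 \<gamma> \<longrightarrow> curve_length J \<delta> \<le> curve_length J \<gamma>)"
proof -
  interpret energy_completion A J
    using assms by unfold_locales
  note Gr0 = \<open>Q\<^sub>0 \<in> Gr A\<close> and Gr1 = \<open>Q\<^sub>1 \<in> Gr A\<close>
  \<comment> \<open>If \<open>eps Q\<^sub>0\<close> were 0, the radius would be \<open>1 / 0 = 0\<close>, which exceeds no norm.\<close>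
  have eps_nz: "eps Q\<^sub>0 \<noteq> 0"
    using \<open>norm (Q\<^sub>0 - Q\<^sub>1) < geodesic_radius Q\<^sub>0\<close> norm_ge_zero[of "Q\<^sub>0 - Q\<^sub>1"]
    by (auto simp: geodesic_radius_def simp del: norm_ge_zero)
  then have close: "2 * norm (eps Q\<^sub>0) * norm (Q\<^sub>0 - Q\<^sub>1) < 1"
    using \<open>norm (Q\<^sub>0 - Q\<^sub>1) < geodesic_radius Q\<^sub>0\<close>
    by (simp add: geodesic_radius_def pos_less_divide_eq mult_ac)
  interpret H: close_idempotents Q\<^sub>0 Q\<^sub>1
    by unfold_locales (simp_all add: GrD[OF Gr0] GrD[OF Gr1] close)
  define P\<^sub>0 P\<^sub>1 where "P\<^sub>0 = extension J Q\<^sub>0" and "P\<^sub>1 = extension J Q\<^sub>1"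
  note proj0 = extension_projection[OF Gr0, folded P\<^sub>0_def]
    and proj1 = extension_projection[OF Gr1, folded P\<^sub>1_def]
    and ext0 = extends_extension[OF GrD(1)[OF Gr0], folded P\<^sub>0_def]
    and ext1 = extends_extension[OF GrD(1)[OF Gr1], folded P\<^sub>1_def]
  have "norm (eps P\<^sub>0) \<le> 1"
    by (rule norm_reflection_le_1[OF proj0(1,3)])
  then have "2 * norm (eps P\<^sub>0) * norm (P\<^sub>0 - P\<^sub>1) \<le> 2 * norm (eps Q\<^sub>0) * norm (Q\<^sub>0 - Q\<^sub>1)"
    using norm_eps_ge_1[OF GrD(2)[OF Gr0] eps_nz]
      extension_lipschitz[OF GrD(1)[OF Gr0] GrD(1)[OF Gr1], folded P\<^sub>0_def P\<^sub>1_def]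
    by (intro mult_mono) auto
  \<comment> \<open>Smallness passes to the completion since reflections have norm at most 1 there and at least 1
    on the original space.\<close>
  with close have "2 * norm (eps P\<^sub>0) * norm (P\<^sub>0 - P\<^sub>1) < 1" by simp
  then interpret L: close_projections P\<^sub>0 P\<^sub>1
    by unfold_locales (simp_all add: proj0 proj1)
  have ext_X: "extends L.X H.X"
    unfolding geodesic_exponent_eq
    by (intro extends_scaleR extends_op_log1p extends_diff extends_compose extends_eps ext0 ext1
        extends_id L.norm_eps_prod_less H.norm_eps_prod_less)
  have \<delta>: "\<delta> = orbit_curve Q\<^sub>0 H.X" by (rule assms(9))
  have ext_\<delta>: "extends (orbit_curve P\<^sub>0 L.X t) (\<delta> t)" for t
    unfolding \<delta> by (intro extends_orbit_curve ext0 ext_X)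
  have "inner (J (blinfun_apply (\<delta> t) f)) (J g) = inner (J f) (J (blinfun_apply (\<delta> t) g))" for t f g
    unfolding extendsD[OF ext_\<delta>, symmetric] by (rule adjoint_pairD[OF L.orbit_curve_self_adjoint])
  moreover have \<delta>_bounded: "\<delta> t \<in> bounded_ops" for t
    unfolding \<delta> by (rule bounded_ops_orbit_curve[OF GrD(3)[OF Gr0] H.exponent_bounded])
  moreover have "\<delta> t o\<^sub>L \<delta> t = \<delta> t" for t
    unfolding \<delta> by (rule orbit_curve_idempotent[OF GrD(2)[OF Gr0]])
  ultimately have \<delta>_Gr: "\<delta> t \<in> Gr A" for t
    by (simp add: Gr_def idempotents_def symmetric_ops_iff)
  have "piecewise_smooth \<delta>"
    unfolding piecewise_smooth_def \<delta>
    by (intro exI[of _ 1] exI[of _ real]) (simp add: smooth_orbit_curve)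
  then have joins: "joining_curve A Q\<^sub>0 Q\<^sub>1 \<delta>"
    unfolding joining_curve_def using \<delta>_Gr H.orbit_curve_1 by (simp add: \<delta>)
  have speed: "finsler J (vector_derivative \<delta> (at t within {0..1})) \<le> norm L.X" if t: "t \<in> {0..1}" for t
  proof -
    let ?v = "\<lambda>P X. orbit_curve ((X o\<^sub>L P) - (P o\<^sub>L X)) X t"
    have "vector_derivative \<delta> (at t within {0..1}) = ?v Q\<^sub>0 H.X"
      using vector_derivative_within_cbox[of 0 1 t \<delta>] t
        orbit_curve_has_vector_derivative[OF t, of Q\<^sub>0 H.X] by (simp add: \<delta>)
    moreover have "extends (?v P\<^sub>0 L.X) (?v Q\<^sub>0 H.X)"
      by (intro extends_orbit_curve extends_diff extends_compose ext0 ext_X)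
    ultimately show ?thesis
      using L.norm_velocity_le[of t] by (simp add: finsler_def extension_eq)
  qed
  have "curve_length J \<delta> \<le> integral {0..1::real} (\<lambda>t. norm L.X)"
    unfolding curve_length_def
    by (rule integral_le[OF speed_integrable[OF joins]]) (use speed in auto)
  then have upper: "curve_length J \<delta> \<le> norm L.X" by simp
  have "norm L.X \<le> curve_length J \<gamma>" if \<gamma>: "joining_curve A Q\<^sub>0 Q\<^sub>1 \<gamma>" for \<gamma>
    using angle_le_curve_length[OF \<gamma>, folded P\<^sub>0_def P\<^sub>1_def]
    by (intro L.norm_exponent_le_angle curve_length_nonneg[OF \<gamma>]) auto
  with upper have "curve_length J \<delta> \<le> curve_length J \<gamma>" if "joining_curve A Q\<^sub>0 Q\<^sub>1 \<gamma>" for \<gamma>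
    using that by (meson order_trans)
  then show ?thesis
    using joins H.idempotent_geodesic_orbit_curve by (simp add: \<delta>)
qed

end
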